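(* Let $R$ be a Noetherian domain, let $H$ be an $R$-algebra, let $T$ be a right $H$-module, and put $S=\operatorname{End}_H(T)$. Assume that $S$ is left Noetherian and that there is an exact sequence of right $H$-modules $$0\longrightarrow H\xrightarrow{\ f\ }T^{\oplus a}\xrightarrow{\ g\ }T^{\oplus b},$$ where $f$ is a left $\operatorname{add}(T)$-approximation of $H$. Put $C=T^{\oplus a}/f(H)$. Then there exist an integer $c\ge 0$ and an injective homomorphism $\widetilde g:C\to T^{\oplus(b+c)}$ of right $H$-modules which is a left $\operatorname{add}(T)$-approximation of $C$. Consequently, $H$ has the double-centralizer property relative to $T$.
   Context: $\operatorname{add}(T)$ is the full subcategory of right $H$-modules consisting of direct summands of finite direct sums of copies of $T$. A homomorphism $f:M\to C$ of right $H$-modules with $C\in\operatorname{add}(T)$ (for a map into a finite direct sum $T^{\oplus m}$ this is automatic) is called a left $\operatorname{add}(T)$-approximation of $M$ if for every $D\in\operatorname{add}(T)$ the map $\operatorname{Hom}_H(C,D)\to\operatorname{Hom}_H(M,D)$, $g\mapsto g\circ f$, is surjective. For a right $H$-module $M$ put $M^*=\operatorname{Hom}_H(M,T)$ (a left $S$-module) and $M^{**}=\operatorname{Hom}_S(M^*,T)$; the evaluation map is $\alpha_M:M\to M^{**}$, $\alpha_M(m)(\varphi)=\varphi(m)$. $H$ has the double-centralizer property relative to $T$ if $\alpha_H:H\to H^{**}$ is an isomorphism. *)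

theory Defs
  imports "HOL-Algebra.Ring_Divisibility"
begin

text \<open>The locale \<open>algebra\<close> of \<open>HOL-Algebra\<close> requires the algebra to be commutative;
  here it is an arbitrary associative unital one.\<close>

locale assoc_algebra = module R H + ring H for R (structure) and H (structure) +
  assumes smult_mult_left:
      "\<lbrakk>a \<in> carrier R; x \<in> carrier H; y \<in> carrier H\<rbrakk> \<Longrightarrow>
        (a \<odot>\<^bsub>H\<^esub> x) \<otimes>\<^bsub>H\<^esub> y = a \<odot>\<^bsub>H\<^esub> (x \<otimes>\<^bsub>H\<^esub> y)"
    and smult_mult_right:
      "\<lbrakk>a \<in> carrier R; x \<in> carrier H; y \<in> carrier H\<rbrakk> \<Longrightarrow>
        x \<otimes>\<^bsub>H\<^esub> (a \<odot>\<^bsub>H\<^esub> y) = a \<odot>\<^bsub>H\<^esub> (x \<otimes>\<^bsub>H\<^esub> y)"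


subsection \<open>Right modules over a noncommutative ring\<close>

text \<open>As for the library record \<open>module\<close>, the fields \<open>mult\<close> and \<open>one\<close> inherited from
  \<open>ring\<close> carry no meaning; only the additive part and the action matter.\<close>

record ('h, 'm) rmodule = "'m ring" +
  ract :: "['m, 'h] \<Rightarrow> 'm" (infixl \<open>\<triangleleft>\<index>\<close> 70)

locale right_module = H?: ring H + M?: abelian_group M
  for H :: "('h, 'x) ring_scheme" (structure) and M :: "('h, 'm) rmodule" (structure) +
  assumes ract_closed:
      "\<lbrakk>x \<in> carrier M; h \<in> carrier H\<rbrakk> \<Longrightarrow> x \<triangleleft>\<^bsub>M\<^esub> h \<in> carrier M"
    and ract_add_ring:
      "\<lbrakk>x \<in> carrier M; h \<in> carrier H; k \<in> carrier H\<rbrakk> \<Longrightarrow>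
        x \<triangleleft>\<^bsub>M\<^esub> (h \<oplus>\<^bsub>H\<^esub> k) = x \<triangleleft>\<^bsub>M\<^esub> h \<oplus>\<^bsub>M\<^esub> x \<triangleleft>\<^bsub>M\<^esub> k"
    and ract_add_mod:
      "\<lbrakk>x \<in> carrier M; y \<in> carrier M; h \<in> carrier H\<rbrakk> \<Longrightarrow>
        (x \<oplus>\<^bsub>M\<^esub> y) \<triangleleft>\<^bsub>M\<^esub> h = x \<triangleleft>\<^bsub>M\<^esub> h \<oplus>\<^bsub>M\<^esub> y \<triangleleft>\<^bsub>M\<^esub> h"
    and ract_assoc:
      "\<lbrakk>x \<in> carrier M; h \<in> carrier H; k \<in> carrier H\<rbrakk> \<Longrightarrow>
        x \<triangleleft>\<^bsub>M\<^esub> (h \<otimes>\<^bsub>H\<^esub> k) = (x \<triangleleft>\<^bsub>M\<^esub> h) \<triangleleft>\<^bsub>M\<^esub> k"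
    and ract_one: "x \<in> carrier M \<Longrightarrow> x \<triangleleft>\<^bsub>M\<^esub> \<one>\<^bsub>H\<^esub> = x"

text \<open>Elements of Hom-sets are extensional functions, so that two homomorphisms are equal
  as soon as they agree on the carrier.\<close>

definition rmod_hom ::
    "('h, 'x) ring_scheme \<Rightarrow> ('h, 'm) rmodule \<Rightarrow> ('h, 'n) rmodule \<Rightarrow> ('m \<Rightarrow> 'n) set" where
  "rmod_hom H M N = {f \<in> carrier M \<rightarrow>\<^sub>E carrier N.
     (\<forall>x \<in> carrier M. \<forall>y \<in> carrier M. f (x \<oplus>\<^bsub>M\<^esub> y) = f x \<oplus>\<^bsub>N\<^esub> f y) \<and>
     (\<forall>x \<in> carrier M. \<forall>h \<in> carrier H. f (x \<triangleleft>\<^bsub>M\<^esub> h) = f x \<triangleleft>\<^bsub>N\<^esub> h)}"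

definition rmod_iso ::
    "('h, 'x) ring_scheme \<Rightarrow> ('h, 'm) rmodule \<Rightarrow> ('h, 'n) rmodule \<Rightarrow> ('m \<Rightarrow> 'n) set" where
  "rmod_iso H M N = {f \<in> rmod_hom H M N. bij_betw f (carrier M) (carrier N)}"

definition regular_rmodule :: "('h, 'x) ring_scheme \<Rightarrow> ('h, 'h) rmodule" where
  "regular_rmodule H =
     \<lparr>carrier = carrier H, mult = mult H, one = one H, zero = zero H, add = add H,
      ract = mult H\<rparr>"

definition rsubmodule :: "('h, 'x) ring_scheme \<Rightarrow> 'm set \<Rightarrow> ('h, 'm) rmodule \<Rightarrow> bool" where
  "rsubmodule H N M \<longleftrightarrow>
     additive_subgroup N M \<and> (\<forall>x \<in> N. \<forall>h \<in> carrier H. x \<triangleleft>\<^bsub>M\<^esub> h \<in> N)"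

text \<open>The action on cosets is \<open>(N + x) h = N + x h\<close>, written as a union over representatives
  in the style of \<open>rcoset_mult\<close>.\<close>

definition quotient_rmodule :: "('h, 'm) rmodule \<Rightarrow> 'm set \<Rightarrow> ('h, 'm set) rmodule" where
  "quotient_rmodule M N =
     \<lparr>carrier = a_rcosets\<^bsub>M\<^esub> N, mult = undefined, one = undefined, zero = N, add = set_add M,
      ract = (\<lambda>X h. \<Union>x\<in>X. N +>\<^bsub>M\<^esub> (x \<triangleleft>\<^bsub>M\<^esub> h))\<rparr>"

text \<open>The direct sum of \<open>n\<close> copies of \<open>T\<close>: tuples indexed by \<open>{..<n}\<close>, with componentwise
  operations.\<close>

definition direct_power :: "('h, 't) rmodule \<Rightarrow> nat \<Rightarrow> ('h, nat \<Rightarrow> 't) rmodule" where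
  "direct_power T n =
     \<lparr>carrier = {..<n} \<rightarrow>\<^sub>E carrier T, mult = undefined, one = undefined,
      zero = (\<lambda>i\<in>{..<n}. \<zero>\<^bsub>T\<^esub>),
      add = (\<lambda>x y. \<lambda>i\<in>{..<n}. x i \<oplus>\<^bsub>T\<^esub> y i),
      ract = (\<lambda>x h. \<lambda>i\<in>{..<n}. x i \<triangleleft>\<^bsub>T\<^esub> h)\<rparr>"


subsection \<open>\<open>add(T)\<close> and left approximations\<close>

definition direct_summand ::
    "('h, 'x) ring_scheme \<Rightarrow> 'm set \<Rightarrow> ('h, 'm) rmodule \<Rightarrow> bool" where
  "direct_summand H N M \<longleftrightarrow> rsubmodule H N M \<and>
     (\<exists>N'. rsubmodule H N' M \<and> N <+>\<^bsub>M\<^esub> N' = carrier M \<and> N \<inter> N' = {\<zero>\<^bsub>M\<^esub>})"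

text \<open>Membership in \<open>add(T)\<close> is up to isomorphism, and the carrier type of the module is
  arbitrary.\<close>

definition in_add ::
    "('h, 'x) ring_scheme \<Rightarrow> ('h, 't) rmodule \<Rightarrow> ('h, 'd) rmodule \<Rightarrow> bool" where
  "in_add H T D \<longleftrightarrow> right_module H D \<and>
     (\<exists>n N. direct_summand H N (direct_power T n) \<and>
        rmod_iso H D ((direct_power T n)\<lparr>carrier := N\<rparr>) \<noteq> {})"

text \<open>HOL cannot quantify over the carrier type of the test modules \<open>D\<close>. The type
  \<^typ>\<open>nat \<Rightarrow> 't\<close> contains an isomorphic copy of every object of \<open>add(T)\<close>, so quantifying over
  modules of this type loses nothing; see \<open>left_add_approx_surj\<close> below, where the type of \<open>D\<close> is
  arbitrary.\<close>

definition left_add_approx ::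
    "('h, 'x) ring_scheme \<Rightarrow> ('h, 't) rmodule \<Rightarrow> ('h, 'm) rmodule \<Rightarrow> ('h, 'c) rmodule \<Rightarrow>
      ('m \<Rightarrow> 'c) \<Rightarrow> bool" where
  "left_add_approx H T M C f \<longleftrightarrow> in_add H T C \<and> f \<in> rmod_hom H M C \<and>
     (\<forall>D :: ('h, nat \<Rightarrow> 't) rmodule. in_add H T D \<longrightarrow>
        (\<lambda>g. compose (carrier M) g f) ` rmod_hom H C D = rmod_hom H M D)"

lemma right_module_direct_power:
  assumes "right_module H T"
  shows "right_module H (direct_power T n)"
proof -
  interpret T: right_module H T by fact
  let ?P = "direct_power T n"
  have ext: "x = y" if "x \<in> carrier ?P" "y \<in> carrier ?P" "\<And>i. i < n \<Longrightarrow> x i = y i" for x y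
    by (rule PiE_ext[of _ "{..<n}" "\<lambda>_. carrier T"]) (use that in \<open>auto simp: direct_power_def\<close>)
  have c: "x i \<in> carrier T" if "x \<in> carrier ?P" "i < n" for x i
    using that by (auto simp: direct_power_def)
  have cl: "x \<oplus>\<^bsub>?P\<^esub> y \<in> carrier ?P" if "x \<in> carrier ?P" "y \<in> carrier ?P" for x y
    using c[OF that(1)] c[OF that(2)] by (simp add: direct_power_def)
  have cl': "x \<triangleleft>\<^bsub>?P\<^esub> h \<in> carrier ?P" if "x \<in> carrier ?P" "h \<in> carrier H" for x h
    using c[OF that(1)] that(2) by (simp add: direct_power_def T.ract_closed)
  have z: "\<zero>\<^bsub>?P\<^esub> \<in> carrier ?P"
    by (simp add: direct_power_def)
  have cmp: "(x \<oplus>\<^bsub>?P\<^esub> y) i = x i \<oplus>\<^bsub>T\<^esub> y i" "(x \<triangleleft>\<^bsub>?P\<^esub> h) i = x i \<triangleleft>\<^bsub>T\<^esub> h"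
    "\<zero>\<^bsub>?P\<^esub> i = \<zero>\<^bsub>T\<^esub>" if "i < n" for x y h i
    using that by (auto simp: direct_power_def)
  have ag: "abelian_group ?P"
  proof (rule abelian_groupI, goal_cases)
    case (6 x)
    let ?y = "\<lambda>i\<in>{..<n}. \<ominus>\<^bsub>T\<^esub> x i"
    have y: "?y \<in> carrier ?P" using c[OF 6] by (auto simp: direct_power_def)
    moreover have "?y \<oplus>\<^bsub>?P\<^esub> x = \<zero>\<^bsub>?P\<^esub>"
      by (rule ext) (use 6 y z c[OF 6] in \<open>simp_all add: cl cmp T.M.l_neg\<close>)
    ultimately show ?case by blast
  next
    case (3 x y z)
    then show ?case using c[of x] c[of y] c[of z]
      by (intro ext) (simp_all add: cl cl' z cmp T.M.a_assoc)
  next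
    case (4 x y)
    then show ?case using c[of x] c[of y]
      by (intro ext) (simp_all add: cl cl' z cmp T.M.a_comm)
  next
    case (5 x)
    then show ?case using c[of x]
      by (intro ext) (simp_all add: cl cl' z cmp )
  qed (simp_all add: cl z)
  show ?thesis
  proof (intro right_module.intro right_module_axioms.intro ag T.H.ring_axioms, goal_cases)
    case 1 then show ?case by (rule cl')
  next
    case (2 x h k)
    then show ?case using c[of x]
      by (intro ext) (simp_all add: cl cl' z cmp T.ract_add_ring)
  next
    case (3 x y h)
    then show ?case using c[of x] c[of y]
      by (intro ext) (simp_all add: cl cl' z cmp T.ract_add_mod)
  next
    case (4 x h k)
    then show ?case using c[of x]
      by (intro ext) (simp_all add: cl cl' z cmp T.ract_assoc)
  next
    case (5 x)
    then show ?case using c[of x]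
      by (intro ext) (simp_all add: cl cl' z cmp T.ract_one)
  qed
qed

lemma right_module_rsubmodule:
  assumes "right_module H M" and "rsubmodule H N M"
  shows "right_module H (M\<lparr>carrier := N\<rparr>)"
proof -
  interpret M: right_module H M by fact
  interpret N: additive_subgroup N M using assms(2) by (simp add: rsubmodule_def)
  have sub: "x \<in> carrier M" if "x \<in> N" for x using that N.a_subset by auto
  have act: "x \<triangleleft>\<^bsub>M\<^esub> h \<in> N" if "x \<in> N" "h \<in> carrier H" for x h
    using that assms(2) by (simp add: rsubmodule_def)
  have ag: "abelian_group (M\<lparr>carrier := N\<rparr>)"
  proof (rule abelian_groupI, goal_cases)
    case (6 x)
    then have "\<ominus>\<^bsub>M\<^esub> x \<in> N" "\<ominus>\<^bsub>M\<^esub> x \<oplus>\<^bsub>M\<^esub> x = \<zero>\<^bsub>M\<^esub>"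
      using N.a_inv_closed sub by (auto simp: M.M.l_neg)
    then show ?case by auto
  qed (simp_all add: sub M.M.a_ac)
  show ?thesis
    by (intro right_module.intro right_module_axioms.intro ag M.H.ring_axioms)
       (simp_all add: sub act M.ract_add_ring M.ract_add_mod M.ract_assoc M.ract_one)
qed

lemma rmod_hom_compose:
  assumes "right_module H M" and "f \<in> rmod_hom H M N" and "g \<in> rmod_hom H N P"
  shows "compose (carrier M) g f \<in> rmod_hom H M P"
proof -
  interpret M: right_module H M by fact
  have "f x \<in> carrier N" if "x \<in> carrier M" for x
    using that assms(2) by (auto simp: rmod_hom_def)
  with assms(2,3) show ?thesis
    by (auto simp: rmod_hom_def compose_def M.ract_closed)
qed

lemma rmod_iso_inverse:
  assumes "right_module H M" and "f \<in> rmod_iso H M N"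
  shows "(\<lambda>y\<in>carrier N. inv_into (carrier M) f y) \<in> rmod_iso H N M"
proof -
  interpret M: right_module H M by fact
  let ?k = "inv_into (carrier M) f"
  have f: "f \<in> rmod_hom H M N" and bij: "bij_betw f (carrier M) (carrier N)"
    using assms(2) by (auto simp: rmod_iso_def)
  have k: "?k y \<in> carrier M" "f (?k y) = y" if "y \<in> carrier N" for y
    using that bij by (auto simp: bij_betw_def inv_into_into f_inv_into_f)
  have kf: "?k (f x) = x" if "x \<in> carrier M" for x
    using that bij by (auto simp: bij_betw_def)
  have f_in: "f x \<in> carrier N" if "x \<in> carrier M" for x
    using that f by (auto simp: rmod_hom_def)
  have add: "y \<oplus>\<^bsub>N\<^esub> z \<in> carrier N \<and> ?k (y \<oplus>\<^bsub>N\<^esub> z) = ?k y \<oplus>\<^bsub>M\<^esub> ?k z"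
    if "y \<in> carrier N" "z \<in> carrier N" for y z
  proof -
    have "f (?k y \<oplus>\<^bsub>M\<^esub> ?k z) = y \<oplus>\<^bsub>N\<^esub> z"
      using f that k by (simp add: rmod_hom_def)
    then show ?thesis using kf f_in k that M.M.a_closed by metis
  qed
  have act: "y \<triangleleft>\<^bsub>N\<^esub> h \<in> carrier N \<and> ?k (y \<triangleleft>\<^bsub>N\<^esub> h) = ?k y \<triangleleft>\<^bsub>M\<^esub> h"
    if "y \<in> carrier N" "h \<in> carrier H" for y h
  proof -
    have "f (?k y \<triangleleft>\<^bsub>M\<^esub> h) = y \<triangleleft>\<^bsub>N\<^esub> h"
      using f that k by (simp add: rmod_hom_def)
    then show ?thesis using kf f_in k that M.ract_closed by metis
  qed
  have "bij_betw (\<lambda>y\<in>carrier N. ?k y) (carrier N) (carrier M)"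
    using bij_betw_inv_into[OF bij] by (simp cong: bij_betw_cong)
  then show ?thesis
    using k add act by (auto simp: rmod_iso_def rmod_hom_def)
qed

lemma left_add_approx_surj:
  fixes T :: "('h, 't) rmodule" and D :: "('h, 'd) rmodule"
  assumes approx: "left_add_approx H T M C f"
    and T: "right_module H T" and M: "right_module H M" and D: "in_add H T D"
  shows "(\<lambda>g. compose (carrier M) g f) ` rmod_hom H C D = rmod_hom H M D"
proof
  have C: "right_module H C" and f: "f \<in> rmod_hom H M C"
    using approx by (auto simp: left_add_approx_def in_add_def)
  show "(\<lambda>g. compose (carrier M) g f) ` rmod_hom H C D \<subseteq> rmod_hom H M D"
    using rmod_hom_compose[OF M f] by blast
  show "rmod_hom H M D \<subseteq> (\<lambda>g. compose (carrier M) g f) ` rmod_hom H C D"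
  proof
    fix p assume p: "p \<in> rmod_hom H M D"
    obtain n N t where N: "direct_summand H N (direct_power T n)"
      and t: "t \<in> rmod_iso H D ((direct_power T n)\<lparr>carrier := N\<rparr>)"
      and D': "right_module H D"
      using D by (auto simp: in_add_def)
    let ?N = "(direct_power T n)\<lparr>carrier := N\<rparr>"
    define u where "u = (\<lambda>y\<in>carrier ?N. inv_into (carrier D) t y)"
    have u: "u \<in> rmod_hom H ?N D"
      using rmod_iso_inverse[OF D' t] by (simp add: rmod_iso_def u_def)
    have th: "t \<in> rmod_hom H D ?N" using t by (simp add: rmod_iso_def)
    have ut: "u (t x) = x" if "x \<in> carrier D" for x
      using t th that by (auto simp: rmod_iso_def bij_betw_def rmod_hom_def u_def)
    \<comment> \<open>the identity shows that the summand \<open>N\<close> itself lies in \<open>add(T)\<close>\<close>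
    have addN: "in_add H T ?N"
    proof -
      have rN: "right_module H ?N"
        using right_module_rsubmodule[OF right_module_direct_power[OF T]] N
        by (auto simp: direct_summand_def)
      interpret N: right_module H ?N by fact
      have "(\<lambda>x\<in>carrier ?N. x) \<in> rmod_hom H ?N ?N"
        unfolding rmod_hom_def mem_Collect_eq
      proof (intro conjI ballI)
        fix x y assume "x \<in> carrier ?N" "y \<in> carrier ?N"
        then show "(\<lambda>x\<in>carrier ?N. x) (x \<oplus>\<^bsub>?N\<^esub> y) =
            (\<lambda>x\<in>carrier ?N. x) x \<oplus>\<^bsub>?N\<^esub> (\<lambda>x\<in>carrier ?N. x) y"
          using N.M.a_closed[of x y] by (simp only: restrict_apply')
      next
        fix x h assume "x \<in> carrier ?N" "h \<in> carrier H"
        then show "(\<lambda>x\<in>carrier ?N. x) (x \<triangleleft>\<^bsub>?N\<^esub> h) = (\<lambda>x\<in>carrier ?N. x) x \<triangleleft>\<^bsub>?N\<^esub> h"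
          using N.ract_closed[of x h] by (simp only: restrict_apply')
      qed simp
      moreover have "bij_betw (\<lambda>x\<in>carrier ?N. x) (carrier ?N) (carrier ?N)"
        by (simp add: bij_betw_def inj_on_def)
      ultimately have "(\<lambda>x\<in>carrier ?N. x) \<in> rmod_iso H ?N ?N"
        by (simp only: rmod_iso_def mem_Collect_eq simp_thms)
      then show ?thesis using N rN unfolding in_add_def by blast
    qed
    have "compose (carrier M) t p \<in> rmod_hom H M ?N"
      by (rule rmod_hom_compose[OF M p th])
    also have "rmod_hom H M ?N = (\<lambda>g. compose (carrier M) g f) ` rmod_hom H C ?N"
      using approx addN unfolding left_add_approx_def by metis
    finally obtain q where q: "q \<in> rmod_hom H C ?N"
      and qf: "compose (carrier M) q f = compose (carrier M) t p"
      by auto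
    have uq: "compose (carrier C) u q \<in> rmod_hom H C D"
      by (rule rmod_hom_compose[OF C q u])
    have "p x = compose (carrier M) (compose (carrier C) u q) f x" for x
    proof (cases "x \<in> carrier M")
      case True
      have "f x \<in> carrier C" "p x \<in> carrier D"
        using True f p by (auto simp: rmod_hom_def)
      moreover have "q (f x) = t (p x)"
        using fun_cong[OF qf, of x] True by (simp add: compose_def)
      ultimately show ?thesis using True ut[of "p x"] by (simp add: compose_def)
    next
      case False
      then show ?thesis using p PiE_arb[of p "carrier M" "\<lambda>_. carrier D" x]
        by (simp add: rmod_hom_def compose_def)
    qed
    then show "p \<in> (\<lambda>g. compose (carrier M) g f) ` rmod_hom H C D"
      using uq by blast
  qed
qed


subsection \<open>The endomorphism ring and the double dual\<close>

definition End_ring :: "('h, 'x) ring_scheme \<Rightarrow> ('h, 't) rmodule \<Rightarrow> ('t \<Rightarrow> 't) ring" where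
  "End_ring H T =
     \<lparr>carrier = rmod_hom H T T,
      mult = (\<lambda>s t. compose (carrier T) s t),
      one = (\<lambda>x\<in>carrier T. x),
      zero = (\<lambda>x\<in>carrier T. \<zero>\<^bsub>T\<^esub>),
      add = (\<lambda>s t. \<lambda>x\<in>carrier T. s x \<oplus>\<^bsub>T\<^esub> t x)\<rparr>"

definition left_ideal :: "'s set \<Rightarrow> ('s, 'y) ring_scheme \<Rightarrow> bool" where
  "left_ideal I S \<longleftrightarrow>
     additive_subgroup I S \<and> (\<forall>s \<in> carrier S. \<forall>x \<in> I. s \<otimes>\<^bsub>S\<^esub> x \<in> I)"

text \<open>One-sided analogue of the library's \<open>noetherian_ring\<close>, which concerns two-sided ideals.\<close>

definition left_noetherian :: "('s, 'y) ring_scheme \<Rightarrow> bool" where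
  "left_noetherian S \<longleftrightarrow> ring S \<and>
     (\<forall>I. left_ideal I S \<longrightarrow>
        (\<exists>A \<subseteq> carrier S. finite A \<and> I = \<Inter>{J. left_ideal J S \<and> A \<subseteq> J}))"

text \<open>Left modules over \<open>S = End(T)\<close> use the library record \<open>module\<close> (the locale of the same name
  demands a commutative base ring).\<close>

definition lmod_hom ::
    "('s, 'y) ring_scheme \<Rightarrow> ('s, 'm) module \<Rightarrow> ('s, 'n) module \<Rightarrow> ('m \<Rightarrow> 'n) set" where
  "lmod_hom S M N = {f \<in> carrier M \<rightarrow>\<^sub>E carrier N.
     (\<forall>x \<in> carrier M. \<forall>y \<in> carrier M. f (x \<oplus>\<^bsub>M\<^esub> y) = f x \<oplus>\<^bsub>N\<^esub> f y) \<and>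
     (\<forall>s \<in> carrier S. \<forall>x \<in> carrier M. f (s \<odot>\<^bsub>M\<^esub> x) = s \<odot>\<^bsub>N\<^esub> f x)}"

definition End_lmodule :: "('h, 't) rmodule \<Rightarrow> ('t \<Rightarrow> 't, 't) module" where
  "End_lmodule T =
     \<lparr>carrier = carrier T, mult = undefined, one = undefined, zero = zero T, add = add T,
      smult = (\<lambda>s x. s x)\<rparr>"

definition dual ::
    "('h, 'x) ring_scheme \<Rightarrow> ('h, 't) rmodule \<Rightarrow> ('h, 'm) rmodule \<Rightarrow>
      ('t \<Rightarrow> 't, 'm \<Rightarrow> 't) module" where
  "dual H T M =
     \<lparr>carrier = rmod_hom H M T, mult = undefined, one = undefined,
      zero = (\<lambda>x\<in>carrier M. \<zero>\<^bsub>T\<^esub>),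
      add = (\<lambda>p q. \<lambda>x\<in>carrier M. p x \<oplus>\<^bsub>T\<^esub> q x),
      smult = (\<lambda>s p. compose (carrier M) s p)\<rparr>"

text \<open>The right \<open>H\<close>-action on the double dual comes from that on \<open>T\<close>: the actions of \<open>S\<close> and \<open>H\<close>
  on \<open>T\<close> commute.\<close>

definition double_dual ::
    "('h, 'x) ring_scheme \<Rightarrow> ('h, 't) rmodule \<Rightarrow> ('h, 'm) rmodule \<Rightarrow>
      ('h, ('m \<Rightarrow> 't) \<Rightarrow> 't) rmodule" where
  "double_dual H T M =
     \<lparr>carrier = lmod_hom (End_ring H T) (dual H T M) (End_lmodule T),
      mult = undefined, one = undefined,
      zero = (\<lambda>p\<in>carrier (dual H T M). \<zero>\<^bsub>T\<^esub>),
      add = (\<lambda>u v. \<lambda>p\<in>carrier (dual H T M). u p \<oplus>\<^bsub>T\<^esub> v p),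
      ract = (\<lambda>u h. \<lambda>p\<in>carrier (dual H T M). u p \<triangleleft>\<^bsub>T\<^esub> h)\<rparr>"

definition evaluation_map ::
    "('h, 'x) ring_scheme \<Rightarrow> ('h, 't) rmodule \<Rightarrow> ('h, 'm) rmodule \<Rightarrow>
      'm \<Rightarrow> ('m \<Rightarrow> 't) \<Rightarrow> 't" where
  "evaluation_map H T M = (\<lambda>m\<in>carrier M. \<lambda>p\<in>carrier (dual H T M). p m)"

definition double_centralizer_property ::
    "('h, 'x) ring_scheme \<Rightarrow> ('h, 't) rmodule \<Rightarrow> bool" where
  "double_centralizer_property H T \<longleftrightarrow>
     evaluation_map H T (regular_rmodule H) \<in>
       rmod_iso H (regular_rmodule H) (double_dual H T (regular_rmodule H))"

end

theory Submission
  imports Defs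
begin

text \<open>Write \<open>S\<close> for the endomorphism ring of \<open>T\<close>, \<open>T\<^sup>n\<close> for the direct power, and \<open>M\<^sup>*\<close> for the
  left \<open>S\<close>-module of homomorphisms from \<open>M\<close> to \<open>T\<close>.

  For the approximation of \<open>C = T\<^sup>a / f(H)\<close>, composition with the quotient map identifies \<open>C\<^sup>*\<close> with
  the submodule \<open>K\<close> of \<open>(T\<^sup>a)\<^sup>*\<close> of maps that vanish on \<open>f(H)\<close>. As \<open>(T\<^sup>a)\<^sup>*\<close> is free of rank \<open>a\<close> over
  the left Noetherian ring \<open>S\<close>, the submodule \<open>K\<close> is generated by finitely many maps
  \<open>k\<^sub>0, \<dots>, k\<^sub>c\<^sub>-\<^sub>1\<close> (\<open>dual_power_lsubmodule_finitely_generated\<close>). The map \<open>(g, k\<^sub>0, \<dots>, k\<^sub>c\<^sub>-\<^sub>1)\<close> from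
  \<open>T\<^sup>a\<close> to \<open>T\<^sup>b\<^sup>+\<^sup>c\<close> descends to \<open>C\<close>. It is injective there because the kernel of \<open>g\<close> is already
  \<open>f(H)\<close>, and every map from \<open>C\<close> to \<open>T\<close> factors through it because the \<open>k\<^sub>i\<close> generate
  (\<open>power_cokernel_approx\<close>). Factoring maps to \<open>T\<close> is enough for an approximation, as every
  object of \<open>add(T)\<close> is a retract of some \<open>T\<^sup>n\<close> (\<open>left_add_approx_direct_powerI\<close>).

  For the double-centralizer property, the argument works for any module \<open>M\<close> in place of \<open>H\<close>
  that embeds as the kernel of \<open>g\<close> by an approximation \<open>f\<close> (\<open>evaluation_map_iso\<close>). Injectivity of the evaluation is seen on the components \<open>f\<^sub>i\<close> of \<open>f\<close>. For
  surjectivity, an \<open>S\<close>-linear map \<open>u\<close> from \<open>M\<^sup>*\<close> to \<open>T\<close> gives the point \<open>t = (u(f\<^sub>i))\<^sub>i\<close> of \<open>T\<^sup>a\<close>, and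
  \<open>u(p \<circ> f) = p(t)\<close> for every \<open>p\<close> in \<open>(T\<^sup>a)\<^sup>*\<close>, by linearity from the case of the coordinate
  projections. Taking for \<open>p\<close> the components of \<open>g\<close> yields \<open>g(t) = u(0) = 0\<close>, so \<open>t = f(m)\<close> for some
  \<open>m\<close> by exactness. As \<open>f\<close> is an approximation, every map \<open>\<phi>\<close> from \<open>M\<close> to \<open>T\<close> has the form
  \<open>p \<circ> f\<close>, so \<open>u(\<phi>) = p(f(m)) = \<phi>(m)\<close>.

  Linear combinations are never written out: that some elements generate a submodule \<open>K\<close> is
  expressed by saying that each submodule which contains them contains \<open>K\<close>, and a property is
  extended from generators by checking that the maps which have it form a submodule.\<close>

section \<open>Homomorphisms of right modules\<close>

lemma rmod_homI:
  assumes "f \<in> extensional (carrier M)"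
    and "\<And>x. x \<in> carrier M \<Longrightarrow> f x \<in> carrier N"
    and "\<And>x y. \<lbrakk>x \<in> carrier M; y \<in> carrier M\<rbrakk> \<Longrightarrow> f (x \<oplus>\<^bsub>M\<^esub> y) = f x \<oplus>\<^bsub>N\<^esub> f y"
    and "\<And>x h. \<lbrakk>x \<in> carrier M; h \<in> carrier H\<rbrakk> \<Longrightarrow> f (x \<triangleleft>\<^bsub>M\<^esub> h) = f x \<triangleleft>\<^bsub>N\<^esub> h"
  shows "f \<in> rmod_hom H M N"
  using assms by (auto simp: rmod_hom_def PiE_iff)

lemma rmod_homD:
  assumes "f \<in> rmod_hom H M N"
  shows "f \<in> extensional (carrier M)"
    and "x \<in> carrier M \<Longrightarrow> f x \<in> carrier N"
    and "\<lbrakk>x \<in> carrier M; y \<in> carrier M\<rbrakk> \<Longrightarrow> f (x \<oplus>\<^bsub>M\<^esub> y) = f x \<oplus>\<^bsub>N\<^esub> f y"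
    and "\<lbrakk>x \<in> carrier M; h \<in> carrier H\<rbrakk> \<Longrightarrow> f (x \<triangleleft>\<^bsub>M\<^esub> h) = f x \<triangleleft>\<^bsub>N\<^esub> h"
  using assms by (auto simp: rmod_hom_def PiE_iff)

lemma rmod_hom_eqI:
  assumes "f \<in> rmod_hom H M N" "g \<in> rmod_hom H M N'" "\<And>x. x \<in> carrier M \<Longrightarrow> f x = g x"
  shows "f = g"
  using assms rmod_homD(1) by (metis extensionalityI)

lemma (in right_module) ract_zero:
  assumes "h \<in> carrier H" shows "\<zero>\<^bsub>M\<^esub> \<triangleleft>\<^bsub>M\<^esub> h = \<zero>\<^bsub>M\<^esub>"
proof -
  have "\<zero>\<^bsub>M\<^esub> \<triangleleft>\<^bsub>M\<^esub> h \<oplus>\<^bsub>M\<^esub> \<zero>\<^bsub>M\<^esub> \<triangleleft>\<^bsub>M\<^esub> h = \<zero>\<^bsub>M\<^esub> \<triangleleft>\<^bsub>M\<^esub> h"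
    using ract_add_mod[of "\<zero>\<^bsub>M\<^esub>" "\<zero>\<^bsub>M\<^esub>" h] assms by simp
  then show ?thesis
    using M.add.r_cancel_one[of "\<zero>\<^bsub>M\<^esub> \<triangleleft>\<^bsub>M\<^esub> h" "\<zero>\<^bsub>M\<^esub> \<triangleleft>\<^bsub>M\<^esub> h"] ract_closed assms by simp
qed

lemma rmod_hom_zero:
  assumes "right_module H M" "right_module H N" "f \<in> rmod_hom H M N"
  shows "f \<zero>\<^bsub>M\<^esub> = \<zero>\<^bsub>N\<^esub>"
proof -
  interpret M: right_module H M by fact
  interpret N: right_module H N by fact
  have "f \<zero>\<^bsub>M\<^esub> \<in> carrier N" "f \<zero>\<^bsub>M\<^esub> = f \<zero>\<^bsub>M\<^esub> \<oplus>\<^bsub>N\<^esub> f \<zero>\<^bsub>M\<^esub>"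
    using rmod_homD[OF assms(3)] M.M.zero_closed M.M.r_zero by metis+
  then show ?thesis
    using N.M.add.r_cancel_one[of "f \<zero>\<^bsub>M\<^esub>" "f \<zero>\<^bsub>M\<^esub>"] by simp
qed

lemma rmod_hom_minus:
  assumes "right_module H M" "right_module H N" "f \<in> rmod_hom H M N" "x \<in> carrier M"
  shows "f (\<ominus>\<^bsub>M\<^esub> x) = \<ominus>\<^bsub>N\<^esub> f x"
proof -
  interpret M: right_module H M by fact
  interpret N: right_module H N by fact
  have "f (\<ominus>\<^bsub>M\<^esub> x) \<oplus>\<^bsub>N\<^esub> f x = \<zero>\<^bsub>N\<^esub>"
    using rmod_homD(3)[OF assms(3), of "\<ominus>\<^bsub>M\<^esub> x" x] assms(4) rmod_hom_zero[OF assms(1-3)]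
    by (simp add: M.M.l_neg)
  then show ?thesis
    using rmod_homD(2)[OF assms(3)] assms(4) N.M.minus_equality by auto
qed

lemma rmod_hom_id:
  assumes "right_module H M"
  shows "(\<lambda>x\<in>carrier M. x) \<in> rmod_hom H M M"
proof -
  interpret M: right_module H M by fact
  show ?thesis by (rule rmod_homI) (auto simp: M.ract_closed)
qed

lemma rmod_hom_const_zero:
  assumes "right_module H M" "right_module H N"
  shows "(\<lambda>x\<in>carrier M. \<zero>\<^bsub>N\<^esub>) \<in> rmod_hom H M N"
proof -
  interpret M: right_module H M by fact
  interpret N: right_module H N by fact
  show ?thesis by (rule rmod_homI) (auto simp: M.ract_closed N.ract_zero)
qed

lemma rmod_hom_plus:
  assumes "right_module H M" "right_module H N" "p \<in> rmod_hom H M N" "q \<in> rmod_hom H M N"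
  shows "(\<lambda>x\<in>carrier M. p x \<oplus>\<^bsub>N\<^esub> q x) \<in> rmod_hom H M N"
proof -
  interpret M: right_module H M by fact
  interpret N: right_module H N by fact
  show ?thesis
    by (rule rmod_homI)
       (auto simp: M.ract_closed N.ract_add_mod rmod_homD[OF assms(3)] rmod_homD[OF assms(4)]
          N.M.a_ac)
qed

lemma rmod_hom_neg:
  assumes "right_module H M"
  shows "(\<lambda>x\<in>carrier M. \<ominus>\<^bsub>M\<^esub> x) \<in> rmod_hom H M M"
proof -
  interpret M: right_module H M by fact
  have "(\<ominus>\<^bsub>M\<^esub> x) \<triangleleft>\<^bsub>M\<^esub> h = \<ominus>\<^bsub>M\<^esub> (x \<triangleleft>\<^bsub>M\<^esub> h)" if "x \<in> carrier M" "h \<in> carrier H" for x h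
    using M.ract_add_mod[of "\<ominus>\<^bsub>M\<^esub> x" x h] that
    by (intro M.M.minus_equality[symmetric]) (simp_all add: M.ract_closed M.ract_zero M.M.l_neg)
  then show ?thesis
    by (intro rmod_homI) (auto simp: M.ract_closed M.M.minus_add)
qed

lemma right_module_regular:
  assumes "ring H"
  shows "right_module H (regular_rmodule H)"
proof -
  interpret H: ring H by fact
  have ag: "abelian_group (regular_rmodule H)"
    by (rule abelian_groupI)
       (auto simp: regular_rmodule_def H.a_ac intro: H.add.l_inv_ex)
  show ?thesis
    by (intro right_module.intro right_module_axioms.intro ag H.ring_axioms)
       (auto simp: regular_rmodule_def H.l_distr H.r_distr H.m_assoc)
qed

section \<open>Quotient modules\<close>

lemma quotient_rmodule_simps:
  assumes M: "right_module H M" and N: "rsubmodule H N M"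
  shows "carrier (quotient_rmodule M N) = (\<lambda>x. N +>\<^bsub>M\<^esub> x) ` carrier M"
    and "\<lbrakk>x \<in> carrier M; y \<in> carrier M\<rbrakk> \<Longrightarrow>
      (N +>\<^bsub>M\<^esub> x) \<oplus>\<^bsub>quotient_rmodule M N\<^esub> (N +>\<^bsub>M\<^esub> y) = N +>\<^bsub>M\<^esub> (x \<oplus>\<^bsub>M\<^esub> y)"
    and "\<lbrakk>x \<in> carrier M; h \<in> carrier H\<rbrakk> \<Longrightarrow>
      (N +>\<^bsub>M\<^esub> x) \<triangleleft>\<^bsub>quotient_rmodule M N\<^esub> h = N +>\<^bsub>M\<^esub> (x \<triangleleft>\<^bsub>M\<^esub> h)"
proof -
  interpret M: right_module H M by fact
  interpret N: additive_subgroup N M using N by (simp add: rsubmodule_def)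
  interpret N: abelian_subgroup N M
    using abelian_subgroupI3[OF N.additive_subgroup_axioms M.M.abelian_group_axioms] .
  show "carrier (quotient_rmodule M N) = (\<lambda>x. N +>\<^bsub>M\<^esub> x) ` carrier M"
    by (auto simp: quotient_rmodule_def A_RCOSETS_def')
  show "(N +>\<^bsub>M\<^esub> x) \<oplus>\<^bsub>quotient_rmodule M N\<^esub> (N +>\<^bsub>M\<^esub> y) = N +>\<^bsub>M\<^esub> (x \<oplus>\<^bsub>M\<^esub> y)"
    if "x \<in> carrier M" "y \<in> carrier M"
    using that by (simp add: quotient_rmodule_def N.a_rcos_sum)
  show "(N +>\<^bsub>M\<^esub> x) \<triangleleft>\<^bsub>quotient_rmodule M N\<^esub> h = N +>\<^bsub>M\<^esub> (x \<triangleleft>\<^bsub>M\<^esub> h)"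
    if x: "x \<in> carrier M" and h: "h \<in> carrier H"
  proof -
    have "N +>\<^bsub>M\<^esub> (y \<triangleleft>\<^bsub>M\<^esub> h) = N +>\<^bsub>M\<^esub> (x \<triangleleft>\<^bsub>M\<^esub> h)" if "y \<in> N +>\<^bsub>M\<^esub> x" for y
    proof -
      obtain n where n: "n \<in> N" "y = n \<oplus>\<^bsub>M\<^esub> x"
        using \<open>y \<in> N +>\<^bsub>M\<^esub> x\<close> by (auto simp: a_r_coset_def')
      have nM: "n \<in> carrier M" using n N.a_subset by auto
      have nh: "n \<triangleleft>\<^bsub>M\<^esub> h \<in> N" using n h N by (simp add: rsubmodule_def)
      then have "y \<triangleleft>\<^bsub>M\<^esub> h \<in> N +>\<^bsub>M\<^esub> (x \<triangleleft>\<^bsub>M\<^esub> h)"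
        using n nM x h by (auto simp: a_r_coset_def' M.ract_add_mod)
      then show ?thesis
        using M.M.a_repr_independence[OF _ M.ract_closed[OF x h] N.a_subgroup] by simp
    qed
    moreover have "x \<in> N +>\<^bsub>M\<^esub> x" using x N.a_rcos_self by auto
    ultimately have "(\<Union>y\<in>N +>\<^bsub>M\<^esub> x. N +>\<^bsub>M\<^esub> (y \<triangleleft>\<^bsub>M\<^esub> h)) = N +>\<^bsub>M\<^esub> (x \<triangleleft>\<^bsub>M\<^esub> h)"
      by blast
    then show ?thesis by (simp add: quotient_rmodule_def)
  qed
qed

lemma right_module_quotient:
  assumes M: "right_module H M" and N: "rsubmodule H N M"
  shows "right_module H (quotient_rmodule M N)"
proof -
  interpret M: right_module H M by fact
  interpret N: additive_subgroup N M using N by (simp add: rsubmodule_def)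
  interpret N: abelian_subgroup N M
    using abelian_subgroupI3[OF N.additive_subgroup_axioms M.M.abelian_group_axioms] .
  let ?C = "quotient_rmodule M N"
  note s = quotient_rmodule_simps[OF M N]
  have z: "\<zero>\<^bsub>?C\<^esub> = N +>\<^bsub>M\<^esub> \<zero>\<^bsub>M\<^esub>"
    using M.M.a_coset_add_zero[OF N.a_subset] by (simp add: quotient_rmodule_def)
  have ag: "abelian_group ?C"
  proof (rule abelian_groupI, goal_cases)
    case (6 X)
    then obtain x where "x \<in> carrier M" "X = N +>\<^bsub>M\<^esub> x" by (auto simp: s)
    then show ?case
      by (intro bexI[of _ "N +>\<^bsub>M\<^esub> (\<ominus>\<^bsub>M\<^esub> x)"]) (auto simp: s z M.M.l_neg)
  qed (auto simp: s z M.M.a_ac)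
  show ?thesis
    by (intro right_module.intro right_module_axioms.intro ag M.H.ring_axioms)
       (auto simp: s M.ract_closed M.ract_add_ring M.ract_add_mod M.ract_assoc M.ract_one)
qed

lemma rmod_hom_quotient_map:
  assumes M: "right_module H M" and N: "rsubmodule H N M"
  shows "(\<lambda>x\<in>carrier M. N +>\<^bsub>M\<^esub> x) \<in> rmod_hom H M (quotient_rmodule M N)"
proof -
  interpret M: right_module H M by fact
  show ?thesis
    by (rule rmod_homI) (auto simp: quotient_rmodule_simps[OF M N] M.ract_closed)
qed

text \<open>The direction of coset equality on which injectivity of maps out of a quotient rests.\<close>

lemma quotient_rmodule_coset_eq:
  assumes M: "right_module H M" and N: "rsubmodule H N M"
    and x: "x \<in> carrier M" and y: "y \<in> carrier M" and d: "x \<ominus>\<^bsub>M\<^esub> y \<in> N"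
  shows "N +>\<^bsub>M\<^esub> x = N +>\<^bsub>M\<^esub> y"
proof -
  interpret M: right_module H M by fact
  interpret N: additive_subgroup N M using N by (simp add: rsubmodule_def)
  have "x = (x \<ominus>\<^bsub>M\<^esub> y) \<oplus>\<^bsub>M\<^esub> y"
    using x y by (simp add: M.M.minus_eq M.M.a_assoc M.M.l_neg)
  then have "x \<in> N +>\<^bsub>M\<^esub> y" using d by (auto simp: a_r_coset_def')
  then show ?thesis using M.M.a_repr_independence[OF _ y N.a_subgroup] by simp
qed

lemma rmod_hom_quotient_lift:
  assumes M: "right_module H M" and N: "rsubmodule H N M" and P: "right_module H P"
    and p: "p \<in> rmod_hom H M P" and van: "\<And>x. x \<in> N \<Longrightarrow> p x = \<zero>\<^bsub>P\<^esub>"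
  obtains q where "q \<in> rmod_hom H (quotient_rmodule M N) P"
    and "\<And>x. x \<in> carrier M \<Longrightarrow> q (N +>\<^bsub>M\<^esub> x) = p x"
proof -
  interpret M: right_module H M by fact
  interpret P: right_module H P by fact
  interpret N: additive_subgroup N M using N by (simp add: rsubmodule_def)
  note s = quotient_rmodule_simps[OF M N]
  define q where "q = (\<lambda>X\<in>carrier (quotient_rmodule M N). the_elem (p ` X))"
  have q: "q (N +>\<^bsub>M\<^esub> x) = p x" if x: "x \<in> carrier M" for x
  proof -
    have "p (n \<oplus>\<^bsub>M\<^esub> x) = p x" if "n \<in> N" for n
      using that x N.a_subset rmod_homD[OF p] van by (auto simp: subset_iff)
    then have "p ` (N +>\<^bsub>M\<^esub> x) = (\<lambda>n. p x) ` N"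
      by (simp add: a_r_coset_def' UNION_singleton_eq_range image_image)
    also have "\<dots> = {p x}" by (rule image_constant[OF N.zero_closed])
    finally have "p ` (N +>\<^bsub>M\<^esub> x) = {p x}" .
    then show ?thesis using x by (simp add: q_def s)
  qed
  have "q \<in> rmod_hom H (quotient_rmodule M N) P"
    by (rule rmod_homI)
       (auto simp: s q rmod_homD[OF p] M.ract_closed, simp add: q_def s)
  then show ?thesis by (rule that[OF _ q])
qed

section \<open>Finite direct powers\<close>

text \<open>Every \<open>x\<close> in \<open>T\<^sup>n\<close> is built up from zero in \<open>n\<close> steps, where step \<open>k\<close> adds the coordinate \<open>x\<^sub>k\<close>
  (\<open>power_trunc_Suc\<close>). Arguments about maps out of \<open>T\<^sup>n\<close> are then inductions on the truncation
  level inside the one module \<open>T\<^sup>n\<close>, without comparing \<open>T\<^sup>n\<close> to \<open>T\<^sup>n\<^sup>+\<^sup>1\<close>.\<close>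

definition power_proj :: "('h, 't) rmodule \<Rightarrow> nat \<Rightarrow> nat \<Rightarrow> (nat \<Rightarrow> 't) \<Rightarrow> 't" where
  "power_proj T n j = (\<lambda>x\<in>carrier (direct_power T n). x j)"

definition power_inj :: "('h, 't) rmodule \<Rightarrow> nat \<Rightarrow> nat \<Rightarrow> 't \<Rightarrow> nat \<Rightarrow> 't" where
  "power_inj T n j = (\<lambda>t\<in>carrier T. \<lambda>i\<in>{..<n}. if i = j then t else \<zero>\<^bsub>T\<^esub>)"

definition power_trunc :: "('h, 't) rmodule \<Rightarrow> nat \<Rightarrow> nat \<Rightarrow> (nat \<Rightarrow> 't) \<Rightarrow> nat \<Rightarrow> 't" where
  "power_trunc T n k =
     (\<lambda>x\<in>carrier (direct_power T n). \<lambda>i\<in>{..<n}. if i < k then x i else \<zero>\<^bsub>T\<^esub>)"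

definition power_tuple ::
    "('h, 'm) rmodule \<Rightarrow> nat \<Rightarrow> (nat \<Rightarrow> 'm \<Rightarrow> 't) \<Rightarrow> 'm \<Rightarrow> nat \<Rightarrow> 't" where
  "power_tuple M n k = (\<lambda>x\<in>carrier M. \<lambda>i\<in>{..<n}. k i x)"

lemma direct_power_simps:
  "x \<in> carrier (direct_power T n) \<longleftrightarrow> x \<in> extensional {..<n} \<and> (\<forall>i<n. x i \<in> carrier T)"
  "i < n \<Longrightarrow> (x \<oplus>\<^bsub>direct_power T n\<^esub> y) i = x i \<oplus>\<^bsub>T\<^esub> y i"
  "i < n \<Longrightarrow> (x \<triangleleft>\<^bsub>direct_power T n\<^esub> h) i = x i \<triangleleft>\<^bsub>T\<^esub> h"
  "i < n \<Longrightarrow> \<zero>\<^bsub>direct_power T n\<^esub> i = \<zero>\<^bsub>T\<^esub>"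
  by (auto simp: direct_power_def PiE_iff)

lemma direct_power_eqI:
  assumes "x \<in> carrier (direct_power T n)" "y \<in> carrier (direct_power T n)"
    and "\<And>i. i < n \<Longrightarrow> x i = y i"
  shows "x = y"
  using assms by (auto simp: direct_power_simps intro: extensionalityI)

lemma power_proj_hom:
  assumes "right_module H T" "j < n"
  shows "power_proj T n j \<in> rmod_hom H (direct_power T n) T"
proof -
  interpret P: right_module H "direct_power T n" using assms(1) by (rule right_module_direct_power)
  show ?thesis
    by (rule rmod_homI) (use assms(2) in \<open>auto simp: power_proj_def P.ract_closed direct_power_simps(2,3)\<close>,
      auto simp: direct_power_simps)
qed

lemma power_tuple_hom:
  assumes M: "right_module H M" and T: "right_module H T"
    and k: "\<And>i. i < n \<Longrightarrow> k i \<in> rmod_hom H M T"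
  shows "power_tuple M n k \<in> rmod_hom H M (direct_power T n)"
proof -
  interpret M: right_module H M by fact
  interpret P: right_module H "direct_power T n" using T by (rule right_module_direct_power)
  have c: "power_tuple M n k x \<in> carrier (direct_power T n)" if "x \<in> carrier M" for x
    using that rmod_homD[OF k] by (auto simp: power_tuple_def direct_power_simps)
  show ?thesis
  proof (rule rmod_homI)
    fix x y assume "x \<in> carrier M" "y \<in> carrier M"
    then show "power_tuple M n k (x \<oplus>\<^bsub>M\<^esub> y)
        = power_tuple M n k x \<oplus>\<^bsub>direct_power T n\<^esub> power_tuple M n k y"
      by (intro direct_power_eqI[of _ T n] c P.M.a_closed M.M.a_closed)
         (simp_all add: direct_power_simps(2), simp add: power_tuple_def rmod_homD[OF k])
  next
    fix x h assume "x \<in> carrier M" "h \<in> carrier H"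
    then show "power_tuple M n k (x \<triangleleft>\<^bsub>M\<^esub> h) = power_tuple M n k x \<triangleleft>\<^bsub>direct_power T n\<^esub> h"
      by (intro direct_power_eqI[of _ T n] c P.ract_closed M.ract_closed)
         (simp_all add: direct_power_simps(3), simp add: power_tuple_def rmod_homD[OF k] M.ract_closed)
  qed (use c in \<open>auto simp: power_tuple_def\<close>)
qed

lemma power_inj_hom:
  assumes T: "right_module H T"
  shows "power_inj T n j \<in> rmod_hom H T (direct_power T n)"
proof -
  have "power_inj T n j = power_tuple T n
      (\<lambda>i. if i = j then (\<lambda>x\<in>carrier T. x) else (\<lambda>x\<in>carrier T. \<zero>\<^bsub>T\<^esub>))"
    by (auto simp: power_inj_def power_tuple_def fun_eq_iff)
  then show ?thesis
    using T by (auto intro!: power_tuple_hom rmod_hom_id rmod_hom_const_zero)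
qed

lemma power_trunc_hom:
  assumes T: "right_module H T"
  shows "power_trunc T n k \<in> rmod_hom H (direct_power T n) (direct_power T n)"
proof -
  have "power_trunc T n k = power_tuple (direct_power T n) n
      (\<lambda>i. if i < k then power_proj T n i else (\<lambda>x\<in>carrier (direct_power T n). \<zero>\<^bsub>T\<^esub>))"
    by (auto simp: power_trunc_def power_tuple_def power_proj_def fun_eq_iff)
  then show ?thesis
    using T by (auto intro!: power_tuple_hom power_proj_hom rmod_hom_const_zero
      right_module_direct_power)
qed

lemma power_trunc_0:
  "x \<in> carrier (direct_power T n) \<Longrightarrow> power_trunc T n 0 x = \<zero>\<^bsub>direct_power T n\<^esub>"
  by (auto simp: power_trunc_def direct_power_def)

lemma power_trunc_all:
  "x \<in> carrier (direct_power T n) \<Longrightarrow> power_trunc T n n x = x"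
  by (auto simp: power_trunc_def direct_power_simps extensional_def)

lemma power_trunc_Suc:
  assumes T: "right_module H T" and x: "x \<in> carrier (direct_power T n)" and k: "k < n"
  shows "power_trunc T n (Suc k) x =
    power_trunc T n k x \<oplus>\<^bsub>direct_power T n\<^esub> power_inj T n k (x k)"
proof -
  interpret T: right_module H T by fact
  interpret P: right_module H "direct_power T n" using T by (rule right_module_direct_power)
  have xi: "x i \<in> carrier T" if "i < n" for i using x that by (simp add: direct_power_simps)
  show ?thesis
  proof (rule direct_power_eqI[of _ T n])
    fix i assume "i < n"
    then show "power_trunc T n (Suc k) x i =
        (power_trunc T n k x \<oplus>\<^bsub>direct_power T n\<^esub> power_inj T n k (x k)) i"
      using x xi k
      by (auto simp: direct_power_simps(2) power_trunc_def power_inj_def less_Suc_eq)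
  qed (use x xi[OF k] rmod_homD(2)[OF power_trunc_hom[OF T]] rmod_homD(2)[OF power_inj_hom[OF T]]
       in auto)
qed

section \<open>Objects of \<open>add(T)\<close> and approximations\<close>

lemma in_add_direct_power:
  assumes T: "right_module H T"
  shows "in_add H T (direct_power T n)"
proof -
  let ?P = "direct_power T n"
  interpret P: right_module H ?P using T by (rule right_module_direct_power)
  have "rsubmodule H (carrier ?P) ?P"
    by (auto simp: rsubmodule_def P.ract_closed additive_subgroup_def P.M.add.subgroup_self)
  moreover have "rsubmodule H {\<zero>\<^bsub>?P\<^esub>} ?P"
    using P.M.add.triv_subgroup by (auto simp: rsubmodule_def P.ract_zero additive_subgroup_def)
  moreover have "carrier ?P <+>\<^bsub>?P\<^esub> {\<zero>\<^bsub>?P\<^esub>} = carrier ?P"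
    by (force simp: set_add_def')
  ultimately have "direct_summand H (carrier ?P) ?P"
    unfolding direct_summand_def by blast
  moreover have "(\<lambda>x\<in>carrier ?P. x) \<in> rmod_iso H ?P (?P\<lparr>carrier := carrier ?P\<rparr>)"
    using rmod_hom_id[OF P.right_module_axioms] by (simp add: rmod_iso_def bij_betw_def inj_on_def)
  ultimately show ?thesis
    using P.right_module_axioms unfolding in_add_def by blast
qed

lemma direct_summand_projection:
  assumes M: "right_module H M" and N: "direct_summand H N M"
  obtains e where "e \<in> rmod_hom H M (M\<lparr>carrier := N\<rparr>)" and "\<And>x. x \<in> N \<Longrightarrow> e x = x"
proof -
  interpret M: right_module H M by fact
  obtain N' where subs: "rsubmodule H N M" "rsubmodule H N' M"
    and sum: "N <+>\<^bsub>M\<^esub> N' = carrier M" and int: "N \<inter> N' = {\<zero>\<^bsub>M\<^esub>}"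
    using N by (auto simp: direct_summand_def)
  interpret N: additive_subgroup N M using subs by (simp add: rsubmodule_def)
  interpret N': additive_subgroup N' M using subs by (simp add: rsubmodule_def)
  have sub: "x \<in> carrier M" if "x \<in> N \<or> x \<in> N'" for x
    using that N.a_subset N'.a_subset by auto
  define e where "e = (\<lambda>x\<in>carrier M. SOME n. n \<in> N \<and> (\<exists>n'\<in>N'. x = n \<oplus>\<^bsub>M\<^esub> n'))"
  \<comment> \<open>Two decompositions \<open>n + n' = m + m'\<close> give \<open>-n + m = n' - m'\<close> in the intersection, which is zero;
    so the choice in the definition of \<open>e\<close> is forced.\<close>
  have e: "e (n \<oplus>\<^bsub>M\<^esub> n') = n" if n: "n \<in> N" "n' \<in> N'" for n n'
  proof -
    have "m = n" if m: "m \<in> N" "m' \<in> N'" and eq: "n \<oplus>\<^bsub>M\<^esub> n' = m \<oplus>\<^bsub>M\<^esub> m'" for m m'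
    proof -
      have c: "n \<in> carrier M" "n' \<in> carrier M" "m \<in> carrier M" "m' \<in> carrier M"
        using n m sub by auto
      have "\<ominus>\<^bsub>M\<^esub> n \<oplus>\<^bsub>M\<^esub> m = \<ominus>\<^bsub>M\<^esub> n \<oplus>\<^bsub>M\<^esub> (n \<oplus>\<^bsub>M\<^esub> n') \<oplus>\<^bsub>M\<^esub> \<ominus>\<^bsub>M\<^esub> m'"
        using c by (simp add: eq M.M.a_assoc M.M.r_neg)
      also have "\<dots> = n' \<oplus>\<^bsub>M\<^esub> \<ominus>\<^bsub>M\<^esub> m'"
        using c by (simp add: M.M.r_neg1)
      finally have "\<ominus>\<^bsub>M\<^esub> n \<oplus>\<^bsub>M\<^esub> m \<in> N \<inter> N'"
        using n m N.a_closed[of "\<ominus>\<^bsub>M\<^esub> n" m] N'.a_closed[of n' "\<ominus>\<^bsub>M\<^esub> m'"] by simp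
      then have "\<ominus>\<^bsub>M\<^esub> n \<oplus>\<^bsub>M\<^esub> m = \<zero>\<^bsub>M\<^esub>" using int by simp
      then have "\<ominus>\<^bsub>M\<^esub> m = \<ominus>\<^bsub>M\<^esub> n" using c by (intro M.M.minus_equality) simp_all
      then show ?thesis using c M.M.minus_minus by metis
    qed
    then have "(SOME m. m \<in> N \<and> (\<exists>m'\<in>N'. n \<oplus>\<^bsub>M\<^esub> n' = m \<oplus>\<^bsub>M\<^esub> m')) = n"
      using n by (intro some_equality) auto
    then show ?thesis using n sub by (simp add: e_def)
  qed
  have dec: "\<exists>n\<in>N. \<exists>n'\<in>N'. x = n \<oplus>\<^bsub>M\<^esub> n'" if "x \<in> carrier M" for x
    using that unfolding sum[symmetric] set_add_def' by blast
  have "e \<in> rmod_hom H M (M\<lparr>carrier := N\<rparr>)"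
  proof (rule rmod_homI)
    fix x assume "x \<in> carrier M"
    then show "e x \<in> carrier (M\<lparr>carrier := N\<rparr>)" using dec[of x] e by auto
  next
    fix x y assume "x \<in> carrier M" "y \<in> carrier M"
    then obtain n n' m m' where *: "n \<in> N" "n' \<in> N'" "m \<in> N" "m' \<in> N'"
      "x = n \<oplus>\<^bsub>M\<^esub> n'" "y = m \<oplus>\<^bsub>M\<^esub> m'" using dec[of x] dec[of y] by blast
    then have "x \<oplus>\<^bsub>M\<^esub> y = (n \<oplus>\<^bsub>M\<^esub> m) \<oplus>\<^bsub>M\<^esub> (n' \<oplus>\<^bsub>M\<^esub> m')"
      using sub by (simp add: M.M.a_ac)
    then show "e (x \<oplus>\<^bsub>M\<^esub> y) = e x \<oplus>\<^bsub>M\<lparr>carrier := N\<rparr>\<^esub> e y"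
      using e[of "n \<oplus>\<^bsub>M\<^esub> m" "n' \<oplus>\<^bsub>M\<^esub> m'"] e[of n n'] e[of m m'] * by simp
  next
    fix x h assume "x \<in> carrier M" and h: "h \<in> carrier H"
    then obtain n n' where *: "n \<in> N" "n' \<in> N'" "x = n \<oplus>\<^bsub>M\<^esub> n'" using dec[of x] by blast
    then have "x \<triangleleft>\<^bsub>M\<^esub> h = n \<triangleleft>\<^bsub>M\<^esub> h \<oplus>\<^bsub>M\<^esub> n' \<triangleleft>\<^bsub>M\<^esub> h"
      using sub h by (simp add: M.ract_add_mod)
    then show "e (x \<triangleleft>\<^bsub>M\<^esub> h) = e x \<triangleleft>\<^bsub>M\<lparr>carrier := N\<rparr>\<^esub> h"
      using e[of "n \<triangleleft>\<^bsub>M\<^esub> h" "n' \<triangleleft>\<^bsub>M\<^esub> h"] e[of n n'] * h subs by (simp add: rsubmodule_def)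
  qed (simp add: e_def)
  moreover have "e x = x" if "x \<in> N" for x
    using e[of x "\<zero>\<^bsub>M\<^esub>"] that sub by simp
  ultimately show ?thesis using that by blast
qed

lemma in_add_retract:
  assumes T: "right_module H T" and D: "in_add H T D"
  obtains n i r where "i \<in> rmod_hom H D (direct_power T n)"
    and "r \<in> rmod_hom H (direct_power T n) D" and "\<And>x. x \<in> carrier D \<Longrightarrow> r (i x) = x"
proof -
  obtain n N t where N: "direct_summand H N (direct_power T n)"
    and t: "t \<in> rmod_iso H D ((direct_power T n)\<lparr>carrier := N\<rparr>)" and D': "right_module H D"
    using D by (auto simp: in_add_def)
  let ?P = "direct_power T n" and ?N = "(direct_power T n)\<lparr>carrier := N\<rparr>"
  have P: "right_module H ?P" using T by (rule right_module_direct_power)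
  define u where "u = (\<lambda>y\<in>carrier ?N. inv_into (carrier D) t y)"
  have u: "u \<in> rmod_hom H ?N D"
    using rmod_iso_inverse[OF D' t] by (simp add: rmod_iso_def u_def)
  have th: "t \<in> rmod_hom H D ?N" using t by (simp add: rmod_iso_def)
  have NP: "N \<subseteq> carrier ?P"
    using N additive_subgroup.a_subset by (auto simp: direct_summand_def rsubmodule_def)
  have ut: "u (t x) = x" if "x \<in> carrier D" for x
    using t th that by (auto simp: rmod_iso_def bij_betw_def rmod_hom_def u_def)
  obtain e where e: "e \<in> rmod_hom H ?P ?N" and eN: "\<And>x. x \<in> N \<Longrightarrow> e x = x"
    using direct_summand_projection[OF P N] by metis
  have tN: "t x \<in> N" if "x \<in> carrier D" for x using rmod_homD(2)[OF th that] by simp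
  have "t \<in> rmod_hom H D ?P"
    using th NP tN by (intro rmod_homI) (auto simp: rmod_homD[OF th])
  moreover have "compose (carrier ?P) u e \<in> rmod_hom H ?P D"
    by (rule rmod_hom_compose[OF P e u])
  moreover have "compose (carrier ?P) u e (t x) = x" if "x \<in> carrier D" for x
    using that tN[OF that] NP eN ut by (auto simp: compose_def)
  ultimately show ?thesis using that by blast
qed

text \<open>A map from \<open>M\<close> to \<open>D\<close> followed by the inclusion of \<open>D\<close> as a retract of some \<open>T\<^sup>n\<close> is a tuple of
  maps to \<open>T\<close>. Factoring each component through \<open>f\<close> and composing with the retraction factors the
  original map.\<close>

lemma left_add_approx_direct_powerI:
  assumes T: "right_module H T" and M: "right_module H M"
    and f: "f \<in> rmod_hom H M (direct_power T m)"
    and factor: "\<And>p. p \<in> rmod_hom H M T \<Longrightarrow>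
      \<exists>q \<in> rmod_hom H (direct_power T m) T. \<forall>x\<in>carrier M. p x = q (f x)"
  shows "left_add_approx H T M (direct_power T m) f"
proof -
  let ?P = "direct_power T m"
  have P: "right_module H ?P" using T by (rule right_module_direct_power)
  have fac: "\<exists>q \<in> rmod_hom H ?P D. p = compose (carrier M) q f"
    if D: "in_add H T D" and p: "p \<in> rmod_hom H M D" for D :: "('a, nat \<Rightarrow> 'c) rmodule" and p
  proof -
    obtain n i r where i: "i \<in> rmod_hom H D (direct_power T n)"
      and r: "r \<in> rmod_hom H (direct_power T n) D" and ri: "\<And>x. x \<in> carrier D \<Longrightarrow> r (i x) = x"
      using in_add_retract[OF T D] by metis
    let ?c = "\<lambda>j. compose (carrier M) (power_proj T n j) (compose (carrier M) i p)"
    have ip: "compose (carrier M) i p \<in> rmod_hom H M (direct_power T n)"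
      by (rule rmod_hom_compose[OF M p i])
    have "?c j \<in> rmod_hom H M T" if "j < n" for j
      by (rule rmod_hom_compose[OF M ip power_proj_hom[OF T that]])
    then have "\<forall>j. \<exists>q. j < n \<longrightarrow> q \<in> rmod_hom H ?P T \<and> (\<forall>x\<in>carrier M. ?c j x = q (f x))"
      using factor by blast
    then obtain q where q: "\<And>j. j < n \<Longrightarrow> q j \<in> rmod_hom H ?P T"
      and qf: "\<And>j x. \<lbrakk>j < n; x \<in> carrier M\<rbrakk> \<Longrightarrow> ?c j x = q j (f x)" by metis
    have Q: "power_tuple ?P n q \<in> rmod_hom H ?P (direct_power T n)"
      by (rule power_tuple_hom[OF P T q])
    have "i (p x) = power_tuple ?P n q (f x)" if x: "x \<in> carrier M" for x
    proof (rule direct_power_eqI[of _ T n])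
      show "i (p x) \<in> carrier (direct_power T n)"
        using rmod_homD(2)[OF i] rmod_homD(2)[OF p] x by simp
      show "power_tuple ?P n q (f x) \<in> carrier (direct_power T n)"
        using rmod_homD(2)[OF Q] rmod_homD(2)[OF f] x by simp
      fix j assume "j < n"
      then show "i (p x) j = power_tuple ?P n q (f x) j"
        using qf[of j x] x rmod_homD(2)[OF i] rmod_homD(2)[OF p] rmod_homD(2)[OF f]
        by (simp add: compose_def power_proj_def power_tuple_def)
    qed
    then have eq: "r (power_tuple ?P n q (f x)) = p x" if "x \<in> carrier M" for x
      using ri[of "p x"] rmod_homD(2)[OF p] that by simp
    have rq: "compose (carrier ?P) r (power_tuple ?P n q) \<in> rmod_hom H ?P D"
      by (rule rmod_hom_compose[OF P Q r])
    moreover have "p = compose (carrier M) (compose (carrier ?P) r (power_tuple ?P n q)) f"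
      by (rule rmod_hom_eqI[OF p rmod_hom_compose[OF M f rq]])
         (use eq rmod_homD(2)[OF f] in \<open>simp add: compose_def\<close>)
    ultimately show ?thesis by blast
  qed
  show ?thesis
    unfolding left_add_approx_def
    using in_add_direct_power[OF T] f fac rmod_hom_compose[OF M f] by blast
qed


text \<open>Here \<open>T\<close> enters through its isomorphic copy \<open>T\<^sup>1\<close>, whose membership in \<open>add(T)\<close> is an instance of
  that of all direct powers.\<close>

lemma left_add_approx_factor:
  assumes T: "right_module H T" and M: "right_module H M"
    and approx: "left_add_approx H T M C f" and p: "p \<in> rmod_hom H M T"
  obtains q where "q \<in> rmod_hom H C T" and "\<And>x. x \<in> carrier M \<Longrightarrow> p x = q (f x)"
proof -
  let ?P = "direct_power T 1"
  have C: "right_module H C" and f: "f \<in> rmod_hom H M C"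
    using approx by (auto simp: left_add_approx_def in_add_def)
  have "compose (carrier M) (power_inj T 1 0) p \<in> rmod_hom H M ?P"
    by (rule rmod_hom_compose[OF M p power_inj_hom[OF T]])
  then obtain q where q: "q \<in> rmod_hom H C ?P"
    and qf: "compose (carrier M) (power_inj T 1 0) p = compose (carrier M) q f"
    using left_add_approx_surj[OF approx T M in_add_direct_power[OF T]] by blast
  have "compose (carrier C) (power_proj T 1 0) q \<in> rmod_hom H C T"
    by (rule rmod_hom_compose[OF C q power_proj_hom[OF T]]) simp
  moreover have "p x = compose (carrier C) (power_proj T 1 0) q (f x)" if x: "x \<in> carrier M" for x
  proof -
    have "power_inj T 1 0 (p x) = q (f x)"
      using fun_cong[OF qf, of x] x by (simp add: compose_def)
    then have "q (f x) 0 = p x"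
      using rmod_homD(2)[OF p x] by (simp add: power_inj_def flip: \<open>power_inj T 1 0 (p x) = q (f x)\<close>)
    then show ?thesis
      using rmod_homD(2)[OF f x] rmod_homD(2)[OF q] by (simp add: compose_def power_proj_def)
  qed
  ultimately show ?thesis using that by blast
qed

section \<open>Submodules of the dual of a direct power\<close>

text \<open>Closure under negatives follows from the other conditions, negation being the action of
  \<open>-1\<close>; see \<open>lsubmodule_dual_diff\<close>.\<close>

definition lsubmodule :: "('s, 'y) ring_scheme \<Rightarrow> 'm set \<Rightarrow> ('s, 'm) module \<Rightarrow> bool" where
  "lsubmodule S L M \<longleftrightarrow> L \<subseteq> carrier M \<and> \<zero>\<^bsub>M\<^esub> \<in> L \<and>
     (\<forall>x\<in>L. \<forall>y\<in>L. x \<oplus>\<^bsub>M\<^esub> y \<in> L) \<and> (\<forall>s\<in>carrier S. \<forall>x\<in>L. s \<odot>\<^bsub>M\<^esub> x \<in> L)"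

text \<open>The additive inverse of \<open>x\<close> is the multiple of \<open>x\<close> by \<open>-1\<close>.\<close>

lemma left_idealI:
  assumes "ring S" and "I \<subseteq> carrier S" and "\<zero>\<^bsub>S\<^esub> \<in> I"
    and "\<And>x y. \<lbrakk>x \<in> I; y \<in> I\<rbrakk> \<Longrightarrow> x \<oplus>\<^bsub>S\<^esub> y \<in> I"
    and "\<And>s x. \<lbrakk>s \<in> carrier S; x \<in> I\<rbrakk> \<Longrightarrow> s \<otimes>\<^bsub>S\<^esub> x \<in> I"
  shows "left_ideal I S"
proof -
  interpret S: ring S by fact
  have "\<ominus>\<^bsub>S\<^esub> x \<in> I" if "x \<in> I" for x
    using assms(5)[of "\<ominus>\<^bsub>S\<^esub> \<one>\<^bsub>S\<^esub>" x] that assms(2) by (auto simp: S.l_minus subset_iff)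
  then have "subgroup I (add_monoid S)"
    using assms(2-4) by (intro S.add.subgroupI) (auto simp: a_inv_def)
  then show ?thesis
    using assms(5) by (simp add: left_ideal_def additive_subgroup_def)
qed

lemma dual_simps:
  "carrier (dual H T M) = rmod_hom H M T"
  "\<zero>\<^bsub>dual H T M\<^esub> = (\<lambda>x\<in>carrier M. \<zero>\<^bsub>T\<^esub>)"
  "p \<oplus>\<^bsub>dual H T M\<^esub> q = (\<lambda>x\<in>carrier M. p x \<oplus>\<^bsub>T\<^esub> q x)"
  "s \<odot>\<^bsub>dual H T M\<^esub> p = compose (carrier M) s p"
  by (simp_all add: dual_def)

lemma End_ring_simps:
  "carrier (End_ring H T) = rmod_hom H T T"
  "\<zero>\<^bsub>End_ring H T\<^esub> = (\<lambda>x\<in>carrier T. \<zero>\<^bsub>T\<^esub>)"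
  "s \<oplus>\<^bsub>End_ring H T\<^esub> t = (\<lambda>x\<in>carrier T. s x \<oplus>\<^bsub>T\<^esub> t x)"
  "s \<otimes>\<^bsub>End_ring H T\<^esub> t = compose (carrier T) s t"
  by (simp_all add: End_ring_def)

lemma lsubmodule_dualI:
  assumes "L \<subseteq> rmod_hom H M T" and "(\<lambda>x\<in>carrier M. \<zero>\<^bsub>T\<^esub>) \<in> L"
    and "\<And>p q. \<lbrakk>p \<in> L; q \<in> L\<rbrakk> \<Longrightarrow> (\<lambda>x\<in>carrier M. p x \<oplus>\<^bsub>T\<^esub> q x) \<in> L"
    and "\<And>s p. \<lbrakk>s \<in> rmod_hom H T T; p \<in> L\<rbrakk> \<Longrightarrow> compose (carrier M) s p \<in> L"
  shows "lsubmodule (End_ring H T) L (dual H T M)"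
  using assms by (simp add: lsubmodule_def dual_simps End_ring_simps)

lemma lsubmodule_dualD:
  assumes "lsubmodule (End_ring H T) L (dual H T M)"
  shows "p \<in> L \<Longrightarrow> p \<in> rmod_hom H M T"
    and "(\<lambda>x\<in>carrier M. \<zero>\<^bsub>T\<^esub>) \<in> L"
    and "\<lbrakk>p \<in> L; q \<in> L\<rbrakk> \<Longrightarrow> (\<lambda>x\<in>carrier M. p x \<oplus>\<^bsub>T\<^esub> q x) \<in> L"
    and "\<lbrakk>s \<in> rmod_hom H T T; p \<in> L\<rbrakk> \<Longrightarrow> compose (carrier M) s p \<in> L"
  using assms by (auto simp: lsubmodule_def dual_simps End_ring_simps)

lemma lsubmodule_dual_diff:
  assumes T: "right_module H T" and L: "lsubmodule (End_ring H T) L (dual H T M)"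
    and p: "p \<in> L" and q: "q \<in> L"
  shows "(\<lambda>x\<in>carrier M. p x \<ominus>\<^bsub>T\<^esub> q x) \<in> L"
proof -
  interpret T: right_module H T by fact
  note D = lsubmodule_dualD[OF L]
  let ?r = "compose (carrier M) (\<lambda>x\<in>carrier T. \<ominus>\<^bsub>T\<^esub> x) q"
  have "(\<lambda>x\<in>carrier M. p x \<oplus>\<^bsub>T\<^esub> ?r x) \<in> L"
    by (intro D(3) D(4) rmod_hom_neg T p q)
  also have "(\<lambda>x\<in>carrier M. p x \<oplus>\<^bsub>T\<^esub> ?r x) = (\<lambda>x\<in>carrier M. p x \<ominus>\<^bsub>T\<^esub> q x)"
    using rmod_homD(2)[OF D(1)[OF q]] by (auto simp: compose_def a_minus_def)
  finally show ?thesis .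
qed

text \<open>A map \<open>p\<close> is the sum of the multiples \<open>(p \<circ> \<iota>\<^sub>j) \<circ> \<pi>\<^sub>j\<close> of the projections, where \<open>\<iota>\<^sub>j\<close> is the
  \<open>j\<close>-th inclusion. The partial sums of this are the composites of \<open>p\<close> with the truncations, on
  which the induction runs.\<close>

lemma dual_power_generated_by_proj:
  assumes T: "right_module H T"
    and L: "lsubmodule (End_ring H T) L (dual H T (direct_power T n))"
    and proj: "\<And>j. j < n \<Longrightarrow> power_proj T n j \<in> L"
    and p: "p \<in> rmod_hom H (direct_power T n) T"
  shows "p \<in> L"
proof -
  let ?P = "direct_power T n"
  have P: "right_module H ?P" using T by (rule right_module_direct_power)
  note D = lsubmodule_dualD[OF L]
  have tr: "power_trunc T n j x \<in> carrier ?P" if "x \<in> carrier ?P" for j x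
    by (rule rmod_homD(2)[OF power_trunc_hom[OF T] that])
  have "compose (carrier ?P) p (power_trunc T n j) \<in> L" if "j \<le> n" for j
    using that
  proof (induction j)
    case 0
    have "compose (carrier ?P) p (power_trunc T n 0) = (\<lambda>x\<in>carrier ?P. \<zero>\<^bsub>T\<^esub>)"
      using rmod_hom_zero[OF P T p] by (auto simp: compose_def power_trunc_0)
    then show ?case using D(2) by (simp only:)
  next
    case (Suc j)
    let ?s = "compose (carrier T) p (power_inj T n j)"
    have s: "?s \<in> rmod_hom H T T" by (rule rmod_hom_compose[OF T power_inj_hom[OF T] p])
    have "compose (carrier ?P) p (power_trunc T n (Suc j)) = (\<lambda>x\<in>carrier ?P.
        compose (carrier ?P) p (power_trunc T n j) x \<oplus>\<^bsub>T\<^esub>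
        compose (carrier ?P) ?s (power_proj T n j) x)"
    proof (rule ext)
      fix x
      show "compose (carrier ?P) p (power_trunc T n (Suc j)) x = (\<lambda>x\<in>carrier ?P.
        compose (carrier ?P) p (power_trunc T n j) x \<oplus>\<^bsub>T\<^esub>
        compose (carrier ?P) ?s (power_proj T n j) x) x"
      proof (cases "x \<in> carrier ?P")
        case True
        then have xj: "x j \<in> carrier T" using Suc.prems by (simp add: direct_power_simps)
        then show ?thesis
          using True Suc.prems rmod_homD(2)[OF power_inj_hom[OF T] xj]
          by (simp add: compose_def power_trunc_Suc[OF T] rmod_homD(3)[OF p] tr power_proj_def)
      qed (simp add: compose_def)
    qed
    then show ?case
      using D(3)[OF Suc.IH D(4)[OF s proj[of j]]] Suc.prems by (simp only: Suc_le_eq less_imp_le)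
  qed
  from this[of n] show ?thesis
    using rmod_homD(1)[OF p]
    by (simp add: compose_def power_trunc_all extensional_restrict cong: restrict_cong)
qed

text \<open>This is the theorem that finitely generated modules over a left Noetherian ring are Noetherian,
  for the free module \<open>(T\<^sup>n)\<^sup>*\<close>. The proof filters \<open>K\<close> by the number of coordinates on which a map
  depends. At each level the maps restricted to the last of these coordinates form a left ideal
  of \<open>S\<close>; lifts of finitely many generators of this ideal, together with generators of the
  previous level, generate the level.\<close>

lemma dual_power_lsubmodule_finitely_generated:
  fixes T :: "('h, 't) rmodule"
  assumes T: "right_module H T" and noeth: "left_noetherian (End_ring H T)"
    and K: "lsubmodule (End_ring H T) K (dual H T (direct_power T n))"
  shows "\<exists>A\<subseteq>K. finite A \<and>
    (\<forall>L. lsubmodule (End_ring H T) L (dual H T (direct_power T n)) \<longrightarrow> A \<subseteq> L \<longrightarrow> K \<subseteq> L)"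
proof -
  let ?P = "direct_power T n" and ?S = "End_ring H T"
  let ?D = "dual H T ?P"
  interpret T: right_module H T by fact
  have P: "right_module H ?P" using T by (rule right_module_direct_power)
  have S: "ring ?S" using noeth by (simp add: left_noetherian_def)
  note KD = lsubmodule_dualD[OF K]
  have tr: "power_trunc T n j x \<in> carrier ?P" if "x \<in> carrier ?P" for j x
    by (rule rmod_homD(2)[OF power_trunc_hom[OF T] that])
  have inj: "power_inj T n j t \<in> carrier ?P" if "t \<in> carrier T" for j t
    by (rule rmod_homD(2)[OF power_inj_hom[OF T] that])
  \<comment> \<open>\<open>lev j\<close> consists of the maps in \<open>K\<close> that depend on the first \<open>j\<close> coordinates only, and \<open>res j\<close>
    restricts a map to the \<open>j\<close>-th summand; a map in \<open>lev (Suc j)\<close> killed by \<open>res j\<close> lies in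
    \<open>lev j\<close>.\<close>
  define lev where
    "lev j = {k \<in> K. \<forall>x\<in>carrier ?P. k (power_trunc T n j x) = k x}" for j
  define res where "res j k = compose (carrier T) k (power_inj T n j)" for j and k :: "(nat \<Rightarrow> 't) \<Rightarrow> 't"
  have lev_sub: "lsubmodule ?S (L \<inter> lev j) ?D" if L: "lsubmodule ?S L ?D" for L j
  proof -
    note LD = lsubmodule_dualD[OF L]
    show ?thesis
      by (rule lsubmodule_dualI)
         (auto simp: lev_def tr compose_def KD LD restrict_def
            intro: KD(2-4)[unfolded compose_def restrict_def] LD(2-4)[unfolded compose_def restrict_def])
  qed
  have res_ideal: "left_ideal (res j ` L) ?S" if L: "lsubmodule ?S L ?D" for L j
  proof (rule left_idealI[OF S])
    note LD = lsubmodule_dualD[OF L]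
    have res: "res j k t = k (power_inj T n j t)" if "t \<in> carrier T" for k t
      using that by (simp add: res_def compose_def)
    have hom: "res j k \<in> rmod_hom H T T" if "k \<in> L" for k
      unfolding res_def by (rule rmod_hom_compose[OF T power_inj_hom[OF T] LD(1)[OF that]])
    show "res j ` L \<subseteq> carrier ?S" using hom by (auto simp: End_ring_simps)
    have "\<zero>\<^bsub>?S\<^esub> = res j (\<lambda>x\<in>carrier ?P. \<zero>\<^bsub>T\<^esub>)"
      by (auto simp: End_ring_simps res_def compose_def inj)
    then show "\<zero>\<^bsub>?S\<^esub> \<in> res j ` L" using LD(2) by blast
    fix s assume "s \<in> res j ` L"
    then obtain k where k: "k \<in> L" "s = res j k" by blast
    show "s \<oplus>\<^bsub>?S\<^esub> t \<in> res j ` L" if t: "t \<in> res j ` L" for t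
    proof -
      obtain l where l: "l \<in> L" "t = res j l" using t by blast
      have "s \<oplus>\<^bsub>?S\<^esub> t = res j (\<lambda>x\<in>carrier ?P. k x \<oplus>\<^bsub>T\<^esub> l x)"
        by (auto simp: k l End_ring_simps res_def compose_def inj)
      then show ?thesis using LD(3) k l by blast
    qed
    show "t \<otimes>\<^bsub>?S\<^esub> s \<in> res j ` L" if "t \<in> carrier ?S" for t
    proof -
      have "t \<otimes>\<^bsub>?S\<^esub> s = res j (compose (carrier ?P) t k)"
        by (auto simp: k End_ring_simps res_def compose_def inj)
      then show ?thesis using LD(4) k that by (auto simp: End_ring_simps)
    qed
  qed
  have "\<exists>A\<subseteq>K. finite A \<and> (\<forall>L. lsubmodule ?S L ?D \<longrightarrow> A \<subseteq> L \<longrightarrow> lev j \<subseteq> L)" if "j \<le> n" for j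
    using that
  proof (induction j)
    case 0
    have "lev 0 \<subseteq> L" if L: "lsubmodule ?S L ?D" for L
    proof
      fix k assume k: "k \<in> lev 0"
      then have kh: "k \<in> rmod_hom H ?P T" using KD(1) by (simp add: lev_def)
      have "k = (\<lambda>x\<in>carrier ?P. \<zero>\<^bsub>T\<^esub>)"
        using rmod_hom_zero[OF P T kh] k
        by (intro rmod_hom_eqI[OF kh rmod_hom_const_zero[OF P T]])
           (auto simp: lev_def power_trunc_0)
      then show "k \<in> L" using lsubmodule_dualD(2)[OF L] by simp
    qed
    then show ?case by (intro exI[of _ "{}"]) simp
  next
    case (Suc j)
    then obtain A where A: "A \<subseteq> K" "finite A"
      and genA: "\<And>L. \<lbrakk>lsubmodule ?S L ?D; A \<subseteq> L\<rbrakk> \<Longrightarrow> lev j \<subseteq> L" by auto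
    have levK: "K \<inter> lev (Suc j) = lev (Suc j)" by (auto simp: lev_def)
    have "left_ideal (res j ` lev (Suc j)) ?S"
      using res_ideal[OF lev_sub[OF K, of "Suc j"]] unfolding levK .
    then obtain B where B: "B \<subseteq> carrier ?S" "finite B"
      and I: "res j ` lev (Suc j) = \<Inter>{J. left_ideal J ?S \<and> B \<subseteq> J}"
      using noeth unfolding left_noetherian_def by meson
    have "B \<subseteq> res j ` lev (Suc j)" unfolding I by blast
    then obtain A' where A': "A' \<subseteq> lev (Suc j)" "finite A'" "B = res j ` A'"
      using B(2) finite_subset_image by metis
    have "lev (Suc j) \<subseteq> L" if L: "lsubmodule ?S L ?D" and sub: "A \<union> A' \<subseteq> L" for L
    proof
      fix k assume k: "k \<in> lev (Suc j)"
      note LD = lsubmodule_dualD[OF L]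
      \<comment> \<open>The restrictions of the elements of \<open>L \<inter> lev (Suc j)\<close> form a left ideal that contains \<open>B\<close>, hence all of
        \<open>res j ` lev (Suc j)\<close>. So \<open>k\<close> agrees with some \<open>l\<close> in \<open>L\<close> on the \<open>j\<close>-th summand, and the
        difference \<open>k - l\<close> drops to the previous level.\<close>
      have "B \<subseteq> res j ` (L \<inter> lev (Suc j))" using A' sub by auto
      then have "res j ` lev (Suc j) \<subseteq> res j ` (L \<inter> lev (Suc j))"
        unfolding I using res_ideal[OF lev_sub[OF L]] by blast
      then obtain l where l: "l \<in> L" "l \<in> lev (Suc j)" and eq: "res j k = res j l"
        using k by blast
      have kh: "k \<in> rmod_hom H ?P T" and lh: "l \<in> rmod_hom H ?P T"
        using k LD(1)[OF l(1)] KD(1) by (auto simp: lev_def)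
      let ?m = "\<lambda>x\<in>carrier ?P. k x \<ominus>\<^bsub>T\<^esub> l x"
      have m: "?m \<in> lev (Suc j)"
        using lsubmodule_dual_diff[OF T lev_sub[OF K, of "Suc j"], unfolded levK, OF k l(2)] .
      have mh: "?m \<in> rmod_hom H ?P T" using m KD(1) by (simp add: lev_def)
      have m0: "?m (power_inj T n j t) = \<zero>\<^bsub>T\<^esub>" if "t \<in> carrier T" for t
        using fun_cong[OF eq, of t] that rmod_homD(2)[OF kh inj] rmod_homD(2)[OF lh inj]
        by (simp add: res_def compose_def inj T.M.minus_eq T.M.r_neg)
      have "?m (power_trunc T n j x) = ?m x" if x: "x \<in> carrier ?P" for x
      proof -
        have xj: "x j \<in> carrier T" using x Suc.prems by (simp add: direct_power_simps)
        have "?m x = ?m (power_trunc T n (Suc j) x)"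
          using m x unfolding lev_def by simp
        also have "\<dots> = ?m (power_trunc T n j x \<oplus>\<^bsub>?P\<^esub> power_inj T n j (x j))"
          using Suc.prems x by (simp add: power_trunc_Suc[OF T])
        also have "\<dots> = ?m (power_trunc T n j x) \<oplus>\<^bsub>T\<^esub> \<zero>\<^bsub>T\<^esub>"
          unfolding rmod_homD(3)[OF mh tr[OF x] inj[OF xj]] m0[OF xj] ..
        also have "\<dots> = ?m (power_trunc T n j x)"
          by (rule T.M.r_zero[OF rmod_homD(2)[OF mh tr[OF x]]])
        finally show ?thesis ..
      qed
      then have "?m \<in> lev j" using m unfolding lev_def by blast
      then have "?m \<in> L" using genA[OF L] sub by blast
      then have "(\<lambda>x\<in>carrier ?P. ?m x \<oplus>\<^bsub>T\<^esub> l x) \<in> L" using LD(3) l(1) by blast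
      also have "(\<lambda>x\<in>carrier ?P. ?m x \<oplus>\<^bsub>T\<^esub> l x) = k"
        using rmod_homD(2)[OF kh] rmod_homD(2)[OF lh] rmod_homD(1)[OF kh]
        by (intro extensionalityI[of _ "carrier ?P"])
           (simp_all add: T.M.minus_eq T.M.a_assoc T.M.l_neg)
      finally show "k \<in> L" .
    qed
    moreover have "A \<union> A' \<subseteq> K" "finite (A \<union> A')"
      using A A' by (auto simp: lev_def)
    ultimately show ?case by blast
  qed
  moreover have "lev n = K" by (auto simp: lev_def power_trunc_all)
  ultimately show ?thesis by (metis order_refl)
qed

section \<open>Cokernels\<close>

lemma rsubmodule_a_kernel:
  assumes M: "right_module H M" and N: "right_module H N" and g: "g \<in> rmod_hom H M N"
  shows "rsubmodule H (a_kernel M N g) M"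
proof -
  interpret M: right_module H M by fact
  interpret N: right_module H N by fact
  have "subgroup (a_kernel M N g) (add_monoid M)"
    using rmod_hom_minus[OF M N g] rmod_hom_zero[OF M N g]
    by (intro M.M.add.subgroupI)
       (auto simp: a_kernel_def' rmod_homD[OF g] simp flip: a_inv_def)
  then show ?thesis
    by (auto simp: rsubmodule_def additive_subgroup_def a_kernel_def' rmod_homD[OF g]
      M.ract_closed N.ract_zero)
qed

text \<open>The generators of the dual of \<open>C\<close> are adjoined to \<open>g\<close>, which by itself makes the induced map
  injective but in general factors too few maps from \<open>C\<close> to \<open>T\<close>.\<close>

lemma power_cokernel_approx:
  assumes T: "right_module H T" and noeth: "left_noetherian (End_ring H T)"
    and g: "g \<in> rmod_hom H (direct_power T a) (direct_power T b)"
  defines "C \<equiv> quotient_rmodule (direct_power T a)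
    (a_kernel (direct_power T a) (direct_power T b) g)"
  shows "\<exists>c g'. g' \<in> rmod_hom H C (direct_power T (b + c)) \<and> inj_on g' (carrier C) \<and>
    left_add_approx H T C (direct_power T (b + c)) g'"
proof -
  let ?P = "direct_power T a" and ?Q = "direct_power T b"
  let ?S = "End_ring H T" and ?D = "dual H T (direct_power T a)"
  interpret T: right_module H T by fact
  interpret P: right_module H ?P using T by (rule right_module_direct_power)
  interpret Q: right_module H ?Q using T by (rule right_module_direct_power)
  note P = P.right_module_axioms and Q = Q.right_module_axioms
  define N where "N = a_kernel ?P ?Q g"
  have N: "rsubmodule H N ?P" unfolding N_def by (rule rsubmodule_a_kernel[OF P Q g])
  have NP: "x \<in> carrier ?P" and gN: "g x = \<zero>\<^bsub>?Q\<^esub>" if "x \<in> N" for x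
    using that by (auto simp: N_def a_kernel_def')
  have C: "right_module H C" unfolding C_def by (rule right_module_quotient[OF P N[unfolded N_def]])
  note s = quotient_rmodule_simps[OF P N, unfolded N_def, folded C_def, folded N_def]
  \<comment> \<open>\<open>K\<close> is the dual of \<open>C\<close>, seen inside the dual of \<open>T\<^sup>a\<close>.\<close>
  define K where "K = {p \<in> rmod_hom H ?P T. \<forall>x\<in>N. p x = \<zero>\<^bsub>T\<^esub>}"
  have "lsubmodule ?S K ?D"
    by (rule lsubmodule_dualI)
       (auto simp: K_def NP rmod_hom_zero[OF T T] compose_def
         intro: rmod_hom_const_zero[OF P T] rmod_hom_plus[OF P T]
           rmod_hom_compose[OF P, unfolded compose_def])
  then obtain A where A: "A \<subseteq> K" "finite A"
    and gen: "\<And>L. \<lbrakk>lsubmodule ?S L ?D; A \<subseteq> L\<rbrakk> \<Longrightarrow> K \<subseteq> L"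
    using dual_power_lsubmodule_finitely_generated[OF T noeth] by metis
  obtain c k where Ak: "A = k ` {i::nat. i < c}"
    using finite_imp_nat_seg_image_inj_on[OF A(2)] by metis
  let ?R = "direct_power T (b + c)"
  have R: "right_module H ?R" using T by (rule right_module_direct_power)
  define G where "G i = (if i < b then compose (carrier ?P) (power_proj T b i) g else k (i - b))" for i
  have GK: "G i \<in> K" if "i < b + c" for i
  proof (cases "i < b")
    case True
    then show ?thesis
      using rmod_hom_compose[OF P g power_proj_hom[OF T True]] NP gN
      by (auto simp: G_def K_def compose_def power_proj_def direct_power_simps(4))
  next
    case False
    then show ?thesis using that A(1) Ak by (auto simp: G_def)
  qed
  define F where "F = power_tuple ?P (b + c) G"
  have F: "F \<in> rmod_hom H ?P ?R"
    unfolding F_def using GK by (intro power_tuple_hom[OF P T]) (auto simp: K_def)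
  have Fi: "F x i = G i x" if "x \<in> carrier ?P" "i < b + c" for x i
    using that by (simp add: F_def power_tuple_def)
  have "F x = \<zero>\<^bsub>?R\<^esub>" if "x \<in> N" for x
  proof (rule direct_power_eqI[of _ T "b + c"])
    show "F x \<in> carrier ?R" by (rule rmod_homD(2)[OF F NP[OF that]])
    show "\<zero>\<^bsub>?R\<^esub> \<in> carrier ?R" using R by (simp add: direct_power_simps(1)) (auto simp: direct_power_def)
    show "F x i = \<zero>\<^bsub>?R\<^esub> i" if "i < b + c" for i
      using GK[OF that] \<open>x \<in> N\<close> NP that by (simp add: Fi K_def direct_power_simps(4))
  qed
  then obtain g' where g': "g' \<in> rmod_hom H C ?R"
    and g'F: "\<And>x. x \<in> carrier ?P \<Longrightarrow> g' (N +>\<^bsub>?P\<^esub> x) = F x"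
    using rmod_hom_quotient_lift[OF P N R F] unfolding C_def N_def by metis
  have "inj_on g' (carrier C)"
  proof (rule inj_onI)
    fix X Y assume "X \<in> carrier C" "Y \<in> carrier C" and eq: "g' X = g' Y"
    then obtain x y where x: "x \<in> carrier ?P" "X = N +>\<^bsub>?P\<^esub> x" and y: "y \<in> carrier ?P" "Y = N +>\<^bsub>?P\<^esub> y"
      by (auto simp: s)
    have "F x = F y" using eq x y g'F by simp
    have "g x = g y"
    proof (rule direct_power_eqI[of _ T b])
      show "g x i = g y i" if "i < b" for i
        using Fi[OF x(1), of i] Fi[OF y(1), of i] \<open>F x = F y\<close> that x y rmod_homD(2)[OF g]
        by (simp add: G_def compose_def power_proj_def)
    qed (use x y rmod_homD(2)[OF g] in auto)
    then have "g (x \<ominus>\<^bsub>?P\<^esub> y) = \<zero>\<^bsub>?Q\<^esub>"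
      using x y rmod_homD(2,3)[OF g] rmod_hom_minus[OF P Q g]
      by (simp add: P.M.minus_eq Q.M.r_neg)
    then have "x \<ominus>\<^bsub>?P\<^esub> y \<in> N"
      using x y by (simp add: N_def a_kernel_def')
    then show "X = Y" using quotient_rmodule_coset_eq[OF P N] x y by simp
  qed
  moreover have "left_add_approx H T C ?R g'"
  proof (rule left_add_approx_direct_powerI[OF T C g'])
    fix p assume p: "p \<in> rmod_hom H C T"
    \<comment> \<open>The maps that factor through \<open>F\<close> form a submodule which contains the generators \<open>k i\<close> of \<open>K\<close>,
      because these are coordinates of \<open>F\<close>.\<close>
    define L where "L = {l \<in> rmod_hom H ?P T. \<exists>q\<in>rmod_hom H ?R T. \<forall>x\<in>carrier ?P. l x = q (F x)}"
    have FR: "F x \<in> carrier ?R" if "x \<in> carrier ?P" for x by (rule rmod_homD(2)[OF F that])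
    have L: "lsubmodule ?S L ?D"
    proof (rule lsubmodule_dualI)
      show "(\<lambda>x\<in>carrier ?P. \<zero>\<^bsub>T\<^esub>) \<in> L"
        using rmod_hom_const_zero[OF P T] FR
        by (auto simp: L_def intro!: bexI[OF _ rmod_hom_const_zero[OF R T]])
      fix l assume l: "l \<in> L"
      then obtain q where q: "q \<in> rmod_hom H ?R T" "\<And>x. x \<in> carrier ?P \<Longrightarrow> l x = q (F x)"
        by (auto simp: L_def)
      show "(\<lambda>x\<in>carrier ?P. l x \<oplus>\<^bsub>T\<^esub> l' x) \<in> L" if l': "l' \<in> L" for l'
      proof -
        obtain q' where q': "q' \<in> rmod_hom H ?R T" "\<And>x. x \<in> carrier ?P \<Longrightarrow> l' x = q' (F x)"
          using l' by (auto simp: L_def)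
        show ?thesis
          using rmod_hom_plus[OF P T] l l' FR q q'
          by (auto simp: L_def intro!: bexI[OF _ rmod_hom_plus[OF R T q(1) q'(1)]])
      qed
      show "compose (carrier ?P) s l \<in> L" if "s \<in> rmod_hom H T T" for s
        using rmod_hom_compose[OF P _ that] l FR q
        by (auto simp: L_def compose_eq intro!: bexI[OF _ rmod_hom_compose[OF R q(1) that]])
    qed (auto simp: L_def)
    have "k i \<in> L" if "i < c" for i
    proof -
      have "k i \<in> rmod_hom H ?P T" using that A(1) Ak by (auto simp: K_def)
      moreover have "power_proj T (b + c) (b + i) \<in> rmod_hom H ?R T"
        using that by (intro power_proj_hom[OF T]) simp
      moreover have "k i x = power_proj T (b + c) (b + i) (F x)" if "x \<in> carrier ?P" for x
        using that \<open>i < c\<close> FR by (simp add: power_proj_def Fi G_def)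
      ultimately show ?thesis unfolding L_def by blast
    qed
    then have "K \<subseteq> L" using gen[OF L] Ak by blast
    let ?q = "\<lambda>x\<in>carrier ?P. N +>\<^bsub>?P\<^esub> x"
    have qh: "?q \<in> rmod_hom H ?P C"
      using rmod_hom_quotient_map[OF P N] unfolding C_def N_def .
    have "p (N +>\<^bsub>?P\<^esub> x) = \<zero>\<^bsub>T\<^esub>" if "x \<in> N" for x
    proof -
      interpret N: additive_subgroup N ?P using N by (simp add: rsubmodule_def)
      have "N +>\<^bsub>?P\<^esub> x = N +>\<^bsub>?P\<^esub> \<zero>\<^bsub>?P\<^esub>"
        using that NP by (intro quotient_rmodule_coset_eq[OF P N]) (auto simp: P.M.minus_eq)
      also have "\<dots> = \<zero>\<^bsub>C\<^esub>"
        using P.M.a_coset_add_zero[OF N.a_subset] by (simp add: C_def quotient_rmodule_def N_def)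
      finally show ?thesis using rmod_hom_zero[OF C T p] by simp
    qed
    then have "compose (carrier ?P) p ?q \<in> K"
      using rmod_hom_compose[OF P qh p] NP by (auto simp: K_def compose_def)
    then obtain r where r: "r \<in> rmod_hom H ?R T"
      and "\<And>x. x \<in> carrier ?P \<Longrightarrow> compose (carrier ?P) p ?q x = r (F x)"
      using \<open>K \<subseteq> L\<close> by (auto simp: L_def)
    then have "p X = r (g' X)" if "X \<in> carrier C" for X
      using that g'F by (auto simp: s compose_def)
    then show "\<exists>q\<in>rmod_hom H ?R T. \<forall>x\<in>carrier C. p x = q (g' x)"
      using r by blast
  qed
  ultimately show ?thesis using g' by blast
qed

section \<open>The evaluation map\<close>

lemma evaluation_map_hom:
  assumes T: "right_module H T" and M: "right_module H M"
  shows "evaluation_map H T M \<in> rmod_hom H M (double_dual H T M)"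
proof -
  interpret T: right_module H T by fact
  interpret M: right_module H M by fact
  have in_dd: "(\<lambda>p\<in>carrier (dual H T M). p m) \<in> carrier (double_dual H T M)"
    if "m \<in> carrier M" for m
    using that rmod_hom_plus[OF M T] rmod_hom_compose[OF M, of _ T _ T]
    by (auto simp: double_dual_def lmod_hom_def dual_simps End_ring_simps End_lmodule_def
      rmod_homD(2) compose_eq)
  show ?thesis
  proof (rule rmod_homI)
    fix x assume x: "x \<in> carrier M"
    show "evaluation_map H T M x \<in> carrier (double_dual H T M)"
      using in_dd[OF x] x by (simp add: evaluation_map_def)
    show "evaluation_map H T M (x \<oplus>\<^bsub>M\<^esub> y) =
        evaluation_map H T M x \<oplus>\<^bsub>double_dual H T M\<^esub> evaluation_map H T M y"
      if "y \<in> carrier M" for y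
      using x that by (auto simp: evaluation_map_def double_dual_def dual_simps rmod_homD(3))
    show "evaluation_map H T M (x \<triangleleft>\<^bsub>M\<^esub> h) = evaluation_map H T M x \<triangleleft>\<^bsub>double_dual H T M\<^esub> h"
      if "h \<in> carrier H" for h
      using x that by (auto simp: evaluation_map_def double_dual_def dual_simps rmod_homD(4)
        M.ract_closed)
  qed (simp add: evaluation_map_def)
qed

text \<open>Exactness gives both halves: a point of \<open>M\<close> is determined by the coordinates of its image
  under \<open>f\<close>, and the point \<open>t\<close> of \<open>T\<^sup>a\<close> that represents a given element \<open>u\<close> of the double dual is
  killed by \<open>g\<close>, hence comes from \<open>M\<close>. The approximation property of \<open>f\<close> then ensures that \<open>u\<close> is
  determined by its values on the maps \<open>p \<circ> f\<close>.\<close>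

lemma evaluation_map_iso:
  assumes T: "right_module H T" and M: "right_module H M"
    and f: "f \<in> rmod_hom H M (direct_power T a)"
    and g: "g \<in> rmod_hom H (direct_power T a) (direct_power T b)"
    and inj: "inj_on f (carrier M)"
    and exact: "f ` carrier M = a_kernel (direct_power T a) (direct_power T b) g"
    and approx: "left_add_approx H T M (direct_power T a) f"
  shows "evaluation_map H T M \<in> rmod_iso H M (double_dual H T M)"
proof -
  let ?P = "direct_power T a" and ?Q = "direct_power T b"
  let ?S = "End_ring H T" and ?ev = "evaluation_map H T M"
  interpret T: right_module H T by fact
  interpret P: right_module H ?P using T by (rule right_module_direct_power)
  interpret Q: right_module H ?Q using T by (rule right_module_direct_power)
  note P = P.right_module_axioms and Q = Q.right_module_axioms
  note fc = rmod_homD(2)[OF f]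
  define fi where "fi i = compose (carrier M) (power_proj T a i) f" for i
  have fi: "fi i \<in> rmod_hom H M T" if "i < a" for i
    unfolding fi_def by (rule rmod_hom_compose[OF M f power_proj_hom[OF T that]])
  have fi_eq: "fi i x = f x i" if "x \<in> carrier M" for i x
    using that fc by (simp add: fi_def compose_def power_proj_def)
  have "inj_on ?ev (carrier M)"
  proof (rule inj_onI)
    fix x y assume x: "x \<in> carrier M" and y: "y \<in> carrier M" and eq: "?ev x = ?ev y"
    have "f x = f y"
    proof (rule direct_power_eqI[OF fc[OF x] fc[OF y]])
      show "f x i = f y i" if "i < a" for i
        using fun_cong[OF eq, of "fi i"] fi[OF that] x y
        by (simp add: evaluation_map_def dual_simps fi_eq)
    qed
    then show "x = y" using inj x y by (simp add: inj_on_def)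
  qed
  moreover have "u \<in> ?ev ` carrier M" if u: "u \<in> carrier (double_dual H T M)" for u
  proof -
    have u_ext: "u \<in> extensional (rmod_hom H M T)"
      and u_cl: "\<And>p. p \<in> rmod_hom H M T \<Longrightarrow> u p \<in> carrier T"
      and u_add: "\<And>p q. \<lbrakk>p \<in> rmod_hom H M T; q \<in> rmod_hom H M T\<rbrakk> \<Longrightarrow>
        u (\<lambda>x\<in>carrier M. p x \<oplus>\<^bsub>T\<^esub> q x) = u p \<oplus>\<^bsub>T\<^esub> u q"
      and u_smult: "\<And>s p. \<lbrakk>s \<in> rmod_hom H T T; p \<in> rmod_hom H M T\<rbrakk> \<Longrightarrow>
        u (compose (carrier M) s p) = s (u p)"
      using u by (auto simp: double_dual_def lmod_hom_def dual_simps End_ring_simps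
        End_lmodule_def PiE_iff)
    have u_zero: "u (\<lambda>x\<in>carrier M. \<zero>\<^bsub>T\<^esub>) = \<zero>\<^bsub>T\<^esub>"
    proof -
      let ?z = "\<lambda>x\<in>carrier M. \<zero>\<^bsub>T\<^esub>"
      have z: "?z \<in> rmod_hom H M T" by (rule rmod_hom_const_zero[OF M T])
      have "compose (carrier M) (\<lambda>x\<in>carrier T. \<zero>\<^bsub>T\<^esub>) ?z = ?z" by (auto simp: compose_def)
      then show ?thesis
        using u_smult[OF rmod_hom_const_zero[OF T T] z] u_cl[OF z] by simp
    qed
    define t where "t = (\<lambda>i\<in>{..<a}. u (fi i))"
    have t: "t \<in> carrier ?P"
      using u_cl[OF fi] by (auto simp: t_def direct_power_simps)
    define L where "L = {p \<in> rmod_hom H ?P T. u (compose (carrier M) p f) = p t}"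
    note pf = rmod_hom_compose[OF M f, where P = T]
    have "lsubmodule ?S L (dual H T ?P)"
    proof (rule lsubmodule_dualI)
      have "compose (carrier M) (\<lambda>x\<in>carrier ?P. \<zero>\<^bsub>T\<^esub>) f = (\<lambda>x\<in>carrier M. \<zero>\<^bsub>T\<^esub>)"
        using fc by (auto simp: compose_def)
      then show "(\<lambda>x\<in>carrier ?P. \<zero>\<^bsub>T\<^esub>) \<in> L"
        using rmod_hom_const_zero[OF P T] t u_zero by (simp add: L_def)
      fix p assume p: "p \<in> L"
      show "(\<lambda>x\<in>carrier ?P. p x \<oplus>\<^bsub>T\<^esub> q x) \<in> L" if q: "q \<in> L" for q
      proof -
        have "compose (carrier M) (\<lambda>x\<in>carrier ?P. p x \<oplus>\<^bsub>T\<^esub> q x) f =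
          (\<lambda>x\<in>carrier M. compose (carrier M) p f x \<oplus>\<^bsub>T\<^esub> compose (carrier M) q f x)"
          using fc by (auto simp: compose_def)
        then show ?thesis
          using p q t u_add[OF pf pf] rmod_hom_plus[OF P T] by (simp add: L_def)
      qed
      show "compose (carrier ?P) s p \<in> L" if s: "s \<in> rmod_hom H T T" for s
      proof -
        have "compose (carrier M) (compose (carrier ?P) s p) f =
          compose (carrier M) s (compose (carrier M) p f)"
          using fc by (auto simp: compose_def)
        then show ?thesis
          using p t u_smult[OF s pf] rmod_hom_compose[OF P _ s] by (simp add: L_def compose_eq)
      qed
    qed (auto simp: L_def)
    moreover have "power_proj T a j \<in> L" if "j < a" for j
      using that power_proj_hom[OF T that] t
      by (simp add: L_def power_proj_def fi_def[unfolded power_proj_def, symmetric] t_def)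
    ultimately have u_p: "u (compose (carrier M) p f) = p t" if "p \<in> rmod_hom H ?P T" for p
      using dual_power_generated_by_proj[OF T _ _ that] unfolding L_def by blast
    \<comment> \<open>Each component of \<open>g\<close> vanishes after composition with \<open>f\<close>, so \<open>u_p\<close> evaluates it at \<open>t\<close> as
      \<open>u\<close> of the zero map.\<close>
    have "g t = \<zero>\<^bsub>?Q\<^esub>"
    proof (rule direct_power_eqI[of _ T b])
      fix i assume i: "i < b"
      let ?gi = "compose (carrier ?P) (power_proj T b i) g"
      have "g (f x) = \<zero>\<^bsub>?Q\<^esub>" if "x \<in> carrier M" for x
        using exact that by (auto simp: a_kernel_def')
      then have "compose (carrier M) ?gi f = (\<lambda>x\<in>carrier M. \<zero>\<^bsub>T\<^esub>)"
        using fc i by (auto simp: compose_def power_proj_def direct_power_simps(4))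
      then have "?gi t = \<zero>\<^bsub>T\<^esub>"
        using u_p[OF rmod_hom_compose[OF P g power_proj_hom[OF T i]]] u_zero by simp
      then show "g t i = \<zero>\<^bsub>?Q\<^esub> i"
        using t i rmod_homD(2)[OF g t] by (simp add: compose_eq power_proj_def direct_power_simps(4))
    qed (use rmod_homD(2)[OF g t] in auto)
    then have "t \<in> f ` carrier M" using t by (simp add: exact a_kernel_def')
    then obtain m where m: "m \<in> carrier M" "t = f m" by blast
    have "u = ?ev m"
    proof (rule extensionalityI[OF u_ext])
      show "?ev m \<in> extensional (rmod_hom H M T)"
        using m by (simp add: evaluation_map_def dual_simps)
      fix p assume p: "p \<in> rmod_hom H M T"
      obtain q where q: "q \<in> rmod_hom H ?P T" and pq: "\<And>x. x \<in> carrier M \<Longrightarrow> p x = q (f x)"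
        using left_add_approx_factor[OF T M approx p] by metis
      have "p = compose (carrier M) q f"
        using pq by (intro rmod_hom_eqI[OF p pf[OF q]]) (simp add: compose_eq)
      then show "u p = ?ev m p"
        using u_p[OF q] m p pq by (simp add: evaluation_map_def dual_simps)
    qed
    then show ?thesis using m by blast
  qed
  ultimately show ?thesis
    using evaluation_map_hom[OF T M] rmod_homD(2)[OF evaluation_map_hom[OF T M]]
    by (auto simp: rmod_iso_def bij_betw_def)
qed

section \<open>Cokernel approximation and double centralizer\<close>

theorem proposition4p3:
  fixes R :: "('r, 'x) ring_scheme"
    and H :: "('r, 'h) module"
    and T :: "('h, 't) rmodule"
    and a b :: nat
    and f :: "'h \<Rightarrow> nat \<Rightarrow> 't"
    and g :: "(nat \<Rightarrow> 't) \<Rightarrow> nat \<Rightarrow> 't"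
  assumes "noetherian_domain R"
    and "assoc_algebra R H"
    and "right_module H T"
    and "left_noetherian (End_ring H T)"
    and "f \<in> rmod_hom H (regular_rmodule H) (direct_power T a)"
    and "g \<in> rmod_hom H (direct_power T a) (direct_power T b)"
    and "inj_on f (carrier H)"
    and "f ` carrier H = a_kernel (direct_power T a) (direct_power T b) g"
    and "left_add_approx H T (regular_rmodule H) (direct_power T a) f"
  shows "(let C = quotient_rmodule (direct_power T a) (f ` carrier H) in
           \<exists>(c::nat) g'. g' \<in> rmod_hom H C (direct_power T (b + c)) \<and>
             inj_on g' (carrier C) \<and>
             left_add_approx H T C (direct_power T (b + c)) g')
         \<and> double_centralizer_property H T"
proof -
  interpret T: right_module H T by fact
  have M: "right_module H (regular_rmodule H)"
    by (rule right_module_regular[OF T.H.ring_axioms])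
  have car: "carrier (regular_rmodule H) = carrier H" by (simp add: regular_rmodule_def)
  show ?thesis
    unfolding Let_def assms(8) double_centralizer_property_def
    using power_cokernel_approx[OF assms(3,4,6)]
      evaluation_map_iso[OF assms(3) M assms(5,6) _ _ assms(9)] assms(7,8) car
    by (metis (no_types, lifting))
qed

end
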